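(* Let $\mathcal Z$ be a diffusion in $\mathbb R^1$ that is regular and without traps (i.e. $P^x(T_y<\infty)>0$ for all $x,y\in\mathbb R^1$, where $T_y$ is the first hitting time of $y$), is symmetric with respect to a $\sigma$-finite measure $m$ (the speed measure) that is absolutely continuous with respect to Lebesgue measure, and has generator of the form $$\frac12a^2(x)\frac{d^2}{dx^2}+c(x)\frac{d}{dx},$$ where $a^2,c\in C(\mathbb R^1)$ and $a(x)\neq 0$ for all $x\in\mathbb R^1$. Let $s\in C^2(\mathbb R^1)$ be the (strictly increasing) scale function of $\mathcal Z$ normalized so that $s(0)=0$, and assume that $\lim_{x\to\infty}s(x)=\infty$. Let $T=(0,\infty)$, let $\mu$ be a finite positive measure on $T$ with total mass $|\mu|$, and set $$u_{T_0}(x,y)=s(x)\wedge s(y),\qquad f_{u_{T_0},\mu}(y)=\int_T u_{T_0}(x,y)\,d\mu(x),\qquad v(x,y)=u_{T_0}(x,y)+f_{u_{T_0},\mu}(y),\qquad x,y\ge 0 .$$ Let $\alpha>0$ and let $\{X_\alpha(t),\ t\in[0,1]\}$ be an $\alpha$-permanental process with kernel $\{v(x,y),\ x,y\in[0,1]\}$. Then $X_\alpha(t)$ is continuous on $[0,\delta]$ for some $\delta>0$, and $$\limsup_{t\downarrow 0}\frac{X_\alpha(t)}{s(t)\log\log 1/t}\le 1+|\mu|\qquad\text{a.s.}$$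
   Context: For $\alpha>0$, an $\alpha$-permanental process with kernel $K=\{K(s,t),\ s,t\in[0,1]\}$ is a stochastic process $\{X_\alpha(t),\ t\in[0,1]\}$ with nonnegative values such that for all $n$, all $t_1,\dots,t_n\in[0,1]$ and all $s_1,\dots,s_n>0$, $$E\left(e^{-\sum_{i=1}^n s_iX_\alpha(t_i)}\right)=\frac{1}{\det\left(I+\mathcal K\,\Sigma\right)^{\alpha}},$$ where $\mathcal K=\{K(t_i,t_j)\}_{i,j=1}^n$ and $\Sigma$ is the diagonal matrix with entries $s_1,\dots,s_n$. Sample path statements are, as usual, understood for a suitable (separable, respectively continuous) version of the process. $u_{T_0}$, restricted to $T\times T$, is the potential density with respect to $m$ of the process obtained by starting $\mathcal Z$ in $T$ and killing it the first time it hits $0$. It is known that an $\alpha$-permanental process with kernel $v$ on $[0,1]$ exists for every $\alpha>0$. *)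

theory Defs
  imports "HOL-Probability.Probability" "Jordan_Normal_Form.Determinant"
begin

section \<open>Diffusions on the real line\<close>

text \<open>
  The process is \<open>Z t\<close> for \<open>t \<ge> 0\<close>; only nonnegative times are meaningful.  The state space is the
  real line.  A path may explode in finite time: the values \<open>\<infinity>\<close> and \<open>-\<infinity>\<close> are cemetery points,
  absorbing by assumption, so the lifetime is the first \<open>t\<close> with \<open>\<bar>Z t w\<bar> = \<infinity>\<close>, and
  the process dies only by leaving the line through one of its ends.
\<close>

definition path_sigma :: "'w measure \<Rightarrow> (real \<Rightarrow> 'w \<Rightarrow> ereal) \<Rightarrow> real \<Rightarrow> 'w measure" where
  "path_sigma M Z t =
     sigma (space M) {Z r -` B \<inter> space M | r B. 0 \<le> r \<and> r \<le> t \<and> B \<in> sets borel}"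

text \<open>
  Stopping times and their events with respect to the right-continuous filtration
  \<open>t \<mapsto> \<Inter>u>t. path_sigma M Z u\<close>.  Stopping times may take the value \<open>\<infinity>\<close>,
  which the library's \<open>stopping_time\<close> does not allow for real time.
\<close>

definition stopping_time_plus ::
    "'w measure \<Rightarrow> (real \<Rightarrow> 'w \<Rightarrow> ereal) \<Rightarrow> ('w \<Rightarrow> ereal) \<Rightarrow> bool" where
  "stopping_time_plus M Z \<tau> \<longleftrightarrow>
     (\<forall>w\<in>space M. 0 \<le> \<tau> w) \<and>
     (\<forall>t\<ge>0. \<forall>u>t. {w \<in> space M. \<tau> w \<le> ereal t} \<in> sets (path_sigma M Z u))"

definition stopped_events ::
    "'w measure \<Rightarrow> (real \<Rightarrow> 'w \<Rightarrow> ereal) \<Rightarrow> ('w \<Rightarrow> ereal) \<Rightarrow> 'w set set" where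
  "stopped_events M Z \<tau> =
     {A \<in> sets M. \<forall>t\<ge>0. \<forall>u>t. {w \<in> A. \<tau> w \<le> ereal t} \<in> sets (path_sigma M Z u)}"

locale real_diffusion =
  fixes M :: "'w measure" and P :: "real \<Rightarrow> 'w measure" and Z :: "real \<Rightarrow> 'w \<Rightarrow> ereal"
  assumes prob_space_P: "\<And>x. prob_space (P x)"
    and sets_P: "\<And>x. sets (P x) = sets M"
    and measurable_Z: "\<And>t. 0 \<le> t \<Longrightarrow> Z t \<in> borel_measurable M"
    and measurable_transition: "\<And>t B. 0 \<le> t \<Longrightarrow> B \<in> sets borel \<Longrightarrow>
          (\<lambda>x. measure (P x) {w \<in> space M. Z t w \<in> B}) \<in> borel_measurable borel"
    and start: "\<And>x. AE w in P x. Z 0 w = ereal x"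
    and continuous_paths: "\<And>w. w \<in> space M \<Longrightarrow> continuous_on {0..} (\<lambda>t. Z t w)"
    and absorbing: "\<And>w r t. w \<in> space M \<Longrightarrow> 0 \<le> r \<Longrightarrow> r \<le> t \<Longrightarrow> \<bar>Z r w\<bar> = \<infinity> \<Longrightarrow> Z t w = Z r w"
    and strong_markov: "\<And>x \<tau> A A' t B.
          stopping_time_plus M Z \<tau> \<Longrightarrow> A \<in> stopped_events M Z \<tau> \<Longrightarrow> 0 \<le> t \<Longrightarrow> B \<in> sets borel \<Longrightarrow>
          A' = {w \<in> A. \<tau> w < \<infinity> \<and> \<bar>Z (real_of_ereal (\<tau> w)) w\<bar> \<noteq> \<infinity>} \<Longrightarrow>
          measure (P x) {w \<in> A'. Z (real_of_ereal (\<tau> w) + t) w \<in> B} =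
          (\<integral>w. indicator A' w *
                 measure (P (real_of_ereal (Z (real_of_ereal (\<tau> w)) w))) {w' \<in> space M. Z t w' \<in> B}
             \<partial>P x)"

definition hitting_time :: "(real \<Rightarrow> 'w \<Rightarrow> ereal) \<Rightarrow> real \<Rightarrow> 'w \<Rightarrow> ereal" where
  "hitting_time Z y w = Inf {ereal t | t. 0 < t \<and> Z t w = ereal y}"

definition regular_without_traps :: "(real \<Rightarrow> 'w measure) \<Rightarrow> (real \<Rightarrow> 'w \<Rightarrow> ereal) \<Rightarrow> bool" where
  "regular_without_traps P Z \<longleftrightarrow>
     (\<forall>x y. 0 < measure (P x) {w \<in> space (P x). hitting_time Z y w < \<infinity>})"

text \<open>Functions on the line are extended by 0 to the cemetery points.\<close>

definition kill :: "(real \<Rightarrow> 'b::zero) \<Rightarrow> ereal \<Rightarrow> 'b" where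
  "kill f z = (if \<bar>z\<bar> = \<infinity> then 0 else f (real_of_ereal z))"

definition semigroup_op ::
    "(real \<Rightarrow> 'w measure) \<Rightarrow> (real \<Rightarrow> 'w \<Rightarrow> ereal) \<Rightarrow> real \<Rightarrow> (real \<Rightarrow> real) \<Rightarrow> real \<Rightarrow> real" where
  "semigroup_op P Z t f x = (\<integral>w. kill f (Z t w) \<partial>P x)"

definition nn_semigroup_op ::
    "(real \<Rightarrow> 'w measure) \<Rightarrow> (real \<Rightarrow> 'w \<Rightarrow> ereal) \<Rightarrow> real \<Rightarrow> (real \<Rightarrow> ennreal) \<Rightarrow> real \<Rightarrow> ennreal" where
  "nn_semigroup_op P Z t f x = (\<integral>\<^sup>+w. kill f (Z t w) \<partial>P x)"

definition symmetric_wrt ::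
    "(real \<Rightarrow> 'w measure) \<Rightarrow> (real \<Rightarrow> 'w \<Rightarrow> ereal) \<Rightarrow> real measure \<Rightarrow> bool" where
  "symmetric_wrt P Z m \<longleftrightarrow>
     (\<forall>t\<ge>0. \<forall>f\<in>borel_measurable borel. \<forall>g\<in>borel_measurable borel.
        (\<integral>\<^sup>+x. f x * nn_semigroup_op P Z t g x \<partial>m) = (\<integral>\<^sup>+x. nn_semigroup_op P Z t f x * g x \<partial>m))"

definition C2 :: "(real \<Rightarrow> real) \<Rightarrow> bool" where
  "C2 f \<longleftrightarrow> (\<forall>x. f field_differentiable at x) \<and> (\<forall>x. deriv f field_differentiable at x) \<and>
            continuous_on UNIV (deriv (deriv f))"

text \<open>
  \<open>f\<close> lies in the domain of the infinitesimal generator and is mapped to \<open>g\<close>: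
  the difference quotients converge in the supremum norm.
\<close>

definition in_generator ::
    "(real \<Rightarrow> 'w measure) \<Rightarrow> (real \<Rightarrow> 'w \<Rightarrow> ereal) \<Rightarrow> (real \<Rightarrow> real) \<Rightarrow> (real \<Rightarrow> real) \<Rightarrow> bool" where
  "in_generator P Z f g \<longleftrightarrow>
     uniform_limit UNIV (\<lambda>t x. (semigroup_op P Z t f x - f x) / t) g (at_right 0)"

text \<open>The form of the generator is prescribed on compactly supported \<open>C2\<close> functions.\<close>

definition has_generator_form ::
    "(real \<Rightarrow> 'w measure) \<Rightarrow> (real \<Rightarrow> 'w \<Rightarrow> ereal) \<Rightarrow> (real \<Rightarrow> real) \<Rightarrow> (real \<Rightarrow> real) \<Rightarrow> bool" where
  "has_generator_form P Z a c \<longleftrightarrow>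
     (\<forall>f. C2 f \<and> compact (closure (support_on UNIV f)) \<longrightarrow>
        in_generator P Z f (\<lambda>x. 1/2 * (a x)\<^sup>2 * deriv (deriv f) x + c x * deriv f x))"

definition scale_function ::
    "(real \<Rightarrow> 'w measure) \<Rightarrow> (real \<Rightarrow> 'w \<Rightarrow> ereal) \<Rightarrow> (real \<Rightarrow> real) \<Rightarrow> bool" where
  "scale_function P Z s \<longleftrightarrow>
     strict_mono s \<and> continuous_on UNIV s \<and>
     (\<forall>a x b. a < x \<and> x < b \<longrightarrow>
        measure (P x) {w \<in> space (P x). hitting_time Z b w < hitting_time Z a w} =
        (s x - s a) / (s b - s a))"

text \<open>
  The speed measure associated with a given choice of the scale function, characterized by the
  expected exit times from bounded intervals through the Green functions.  Both the scale function
  and the symmetrizing measure are only determined up to a factor; this normalization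
  is the one under which \<open>min (s x) (s y)\<close> is the potential density with respect to \<open>m\<close>
  of the process on \<open>(0,\<infinity>)\<close> killed at 0 (\<open>m\<close> is twice Lebesgue measure for
  Brownian motion and \<open>s x = x\<close>).
\<close>

definition green_fun :: "(real \<Rightarrow> real) \<Rightarrow> real \<Rightarrow> real \<Rightarrow> real \<Rightarrow> real \<Rightarrow> real" where
  "green_fun s a b x y = (s (min x y) - s a) * (s b - s (max x y)) / (s b - s a)"

definition speed_measure ::
    "(real \<Rightarrow> 'w measure) \<Rightarrow> (real \<Rightarrow> 'w \<Rightarrow> ereal) \<Rightarrow> (real \<Rightarrow> real) \<Rightarrow> real measure \<Rightarrow> bool" where
  "speed_measure P Z s m \<longleftrightarrow>
     sets m = sets borel \<and>
     (\<forall>a x b. a < x \<and> x < b \<longrightarrow>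
        (\<integral>\<^sup>+w. e2ennreal (min (hitting_time Z a w) (hitting_time Z b w)) \<partial>P x) =
        (\<integral>\<^sup>+y. ennreal (green_fun s a b x y) * indicator {a<..<b} y \<partial>m))"


section \<open>Permanental processes\<close>

definition kernel_mat :: "nat \<Rightarrow> (real \<Rightarrow> real \<Rightarrow> real) \<Rightarrow> (nat \<Rightarrow> real) \<Rightarrow> real mat" where
  "kernel_mat n K t = Matrix.mat n n (\<lambda>(i, j). K (t i) (t j))"

text \<open>
  In the Laplace transform below the determinant is automatically positive: it is
  continuous in \<open>\<sigma>\<close>, tends to 1 as \<open>\<sigma> \<rightarrow> 0\<close>, and cannot vanish since the left-hand side is positive
  (\<open>0 powr \<alpha> = 0\<close> and \<open>1 / 0 = 0\<close>).
\<close>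

definition permanental_process ::
    "real \<Rightarrow> real set \<Rightarrow> (real \<Rightarrow> real \<Rightarrow> real) \<Rightarrow> 'b measure \<Rightarrow> (real \<Rightarrow> 'b \<Rightarrow> real) \<Rightarrow> bool" where
  "permanental_process \<alpha> S K N X \<longleftrightarrow>
     prob_space N \<and>
     (\<forall>t\<in>S. X t \<in> borel_measurable N) \<and>
     (\<forall>t\<in>S. \<forall>w\<in>space N. 0 \<le> X t w) \<and>
     (\<forall>n t \<sigma>. (\<forall>i<n. t i \<in> S \<and> 0 < \<sigma> i) \<longrightarrow>
        (\<integral>w. exp (- (\<Sum>i<n. \<sigma> i * X (t i) w)) \<partial>N) =
        1 / Determinant.det (1\<^sub>m n + kernel_mat n K t * mat_diag n \<sigma>) powr \<alpha>)"

definition is_version ::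
    "real set \<Rightarrow> 'b measure \<Rightarrow> (real \<Rightarrow> 'b \<Rightarrow> real) \<Rightarrow> (real \<Rightarrow> 'b \<Rightarrow> real) \<Rightarrow> bool" where
  "is_version S N X Y \<longleftrightarrow>
     (\<forall>t\<in>S. Y t \<in> borel_measurable N \<and> (AE w in N. Y t w = X t w))"


section \<open>The kernel\<close>

definition u_T0 :: "(real \<Rightarrow> real) \<Rightarrow> real \<Rightarrow> real \<Rightarrow> real" where
  "u_T0 s x y = min (s x) (s y)"

definition potential_fun :: "(real \<Rightarrow> real \<Rightarrow> real) \<Rightarrow> real measure \<Rightarrow> real \<Rightarrow> real" where
  "potential_fun u \<mu> y = (\<integral>x. u x y \<partial>\<mu>)"

definition v_kernel :: "(real \<Rightarrow> real) \<Rightarrow> real measure \<Rightarrow> real \<Rightarrow> real \<Rightarrow> real" where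
  "v_kernel s \<mu> x y = u_T0 s x y + potential_fun (u_T0 s) \<mu> y"

end

theory Submission
  imports Defs
begin

text \<open>
  Only one- and two-point marginals of the process matter.  For \<open>r \<le> t\<close> the kernel satisfies
  \<open>v t t * v r r - v t r * v r t = v r r * (s t - s r)\<close>, so the two-point Laplace transform is
  explicit; continued to arguments of mixed sign it gives exponential tails for \<open>X t - X r\<close> on the
  scale \<open>sqrt (s t * (s t - s r))\<close>.  Chaining along dyadic points produces a continuous version and
  controls the oscillation on the blocks \<open>[\<theta>^(k+1), \<theta>^k]\<close>, while the one-point tail, at scale
  \<open>v t t \<le> (1 + \<bar>\<mu>\<bar>) * s t\<close>, gives the constant by Borel-Cantelli as \<open>\<theta>\<close> tends to 1.

  The diffusion enters only through \<open>s t \<ge> k * t\<close> near 0, without which \<open>ln (ln (1 / t))\<close> could be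
  of smaller order than \<open>ln (ln (1 / s t))\<close>.  This bound comes from comparing \<open>s\<close> with a test function
  on which the generator is positive near 0: along the diffusion it is a submartingale up to the
  exit from an interval, and the exit probabilities are given by \<open>s\<close>.
\<close>

section \<open>The scale function near 0\<close>

text \<open>Being \<open>C2\<close> and strictly increasing would still allow \<open>s\<close> to be
  flat at 0, and the form of the generator is prescribed only on compactly supported functions, so
  it cannot be applied to \<open>s\<close> itself. This forces the detour through a compactly
  supported test function that grows linearly at 0. Optional stopping is carried out along the times
  \<open>j / (n + 1)\<close>, where the Markov property at deterministic times suffices; continuity
  of paths converts exits seen on arbitrarily fine grids into an order of hitting times.

  The kernel \<open>v\<close> is not symmetric, so the Laplace transform is the only handle on
  increments, and an exponential moment of a difference needs one argument of negative sign.

  The scale \<open>sqrt (s t * (s t - s r))\<close> is smaller near 0 than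
  \<open>sqrt (s t - s r)\<close>. This extra factor makes the oscillation over a block of order
  \<open>\<theta>^k * sqrt (1 - \<theta>)\<close> times the iterated logarithm. The bound
  \<open>k * t \<le> s t\<close> turns this into a multiple of \<open>s\<close> at the left end of
  the block, with a factor that vanishes as \<theta> tends to 1; hence only the values at the block
  ends contribute to the constant.\<close>

lemma path_sigma_sets:
  "sets (path_sigma M Z t) = sigma_sets (space M) {Z r -` B \<inter> space M | r B. 0 \<le> r \<and> r \<le> t \<and> B \<in> sets borel}"
  "space (path_sigma M Z t) = space M"
  unfolding path_sigma_def by (rule sets_measure_of space_measure_of, blast)+

lemma path_sigma_mono: "t \<le> u \<Longrightarrow> sets (path_sigma M Z t) \<subseteq> sets (path_sigma M Z u)"
  unfolding path_sigma_sets by (intro sigma_sets_mono') force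

lemma measurable_path_sigma:
  assumes "0 \<le> r" "r \<le> t"
  shows "Z r \<in> borel_measurable (path_sigma M Z t)"
  using assms by (intro measurableI) (auto simp: path_sigma_sets intro!: sigma_sets.Basic)

context real_diffusion
begin

lemma space_P [simp]: "space (P x) = space M"
  using sets_eq_imp_space_eq[OF sets_P] .

lemma path_sigma_subset: "sets (path_sigma M Z t) \<subseteq> sets M"
  unfolding path_sigma_sets
  by (intro sets.sigma_sets_subset) (blast intro: measurable_sets measurable_Z)

lemma measurable_Z_P [measurable]: "0 \<le> t \<Longrightarrow> Z t \<in> borel_measurable (P x)"
  using measurable_Z[of t] by (simp only: measurable_cong_sets[OF sets_P refl])

lemma emeasure_P: "emeasure (P x) A = ennreal (measure (P x) A)"
  by (rule finite_measure.emeasure_eq_measure[OF prob_space.axioms(1)[OF prob_space_P]])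

section \<open>The Markov property at deterministic times for nonnegative functions\<close>

lemma measurable_nn_transition:
  fixes f :: "ereal \<Rightarrow> ennreal"
  assumes "f \<in> borel_measurable borel" and t: "0 \<le> t"
  shows "(\<lambda>x. \<integral>\<^sup>+w. f (Z t w) \<partial>P x) \<in> borel_measurable borel"
  using assms(1)
proof (induct rule: borel_measurable_induct)
  case (cong f g)
  then show ?case by simp
next
  case (set B)
  have "(\<integral>\<^sup>+w. indicator B (Z t w) \<partial>P x) = ennreal (measure (P x) {w \<in> space M. Z t w \<in> B})" for x
  proof -
    have [measurable]: "{w \<in> space M. Z t w \<in> B} \<in> sets (P x)"
      using measurable_sets[OF measurable_Z[OF t] set] by (simp add: sets_P vimage_def Int_def conj_commute)
    have "(\<integral>\<^sup>+w. indicator B (Z t w) \<partial>P x) = (\<integral>\<^sup>+w. indicator {w \<in> space M. Z t w \<in> B} w \<partial>P x)"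
      by (intro nn_integral_cong) (auto split: split_indicator)
    then show ?thesis
      by (simp add: emeasure_P)
  qed
  then show ?case
    using measurable_transition[OF t set] by simp
next
  case (mult u c)
  then show ?case
    using t by (simp add: nn_integral_cmult measurable_compose[OF measurable_Z_P])
next
  case (add u v)
  then show ?case
    using t by (simp add: nn_integral_add measurable_compose[OF measurable_Z_P])
next
  case (seq U)
  have "(\<integral>\<^sup>+w. (\<Squnion> range U) (Z t w) \<partial>P x) = (SUP i. \<integral>\<^sup>+w. U i (Z t w) \<partial>P x)" for x
    using seq t unfolding SUP_apply
    by (subst nn_integral_monotone_convergence_SUP[symmetric])
      (auto simp: measurable_compose[OF measurable_Z_P] incseq_def le_fun_def)
  then show ?case
    using seq by simp
qed

text \<open>A constant time \<open>r\<close> is a stopping time and every event known at time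
  \<open>r\<close> is a stopped event for it, so the strong Markov assumption gives the claim for
  indicators; linearity and monotone limits extend it. Nonnegative integrals avoid integrability
  conditions during that extension.\<close>

lemma simple_markov_nn:
  fixes f :: "ereal \<Rightarrow> ennreal"
  assumes f: "f \<in> borel_measurable borel" and r: "0 \<le> r" and t: "0 \<le> t"
    and A: "A \<in> sets (path_sigma M Z r)" "\<And>w. w \<in> A \<Longrightarrow> \<bar>Z r w\<bar> \<noteq> \<infinity>"
  shows "(\<integral>\<^sup>+w. indicator A w * f (Z (r + t) w) \<partial>P x) =
    (\<integral>\<^sup>+w. indicator A w * (\<integral>\<^sup>+w'. f (Z t w') \<partial>P (real_of_ereal (Z r w))) \<partial>P x)"
proof -
  have AM: "A \<in> sets M"
    using A path_sigma_subset by blast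
  then have AP [measurable]: "A \<in> sets (P x)"
    by (simp add: sets_P)
  have AS: "A \<subseteq> space M"
    using sets.sets_into_space[OF AM] .
  have st: "stopping_time_plus M Z (\<lambda>_. ereal r)"
  proof -
    have "{w \<in> space M. ereal r \<le> ereal t'} \<in> sets (path_sigma M Z u)" for t' u
      using sets.top[of "path_sigma M Z u"] by (cases "r \<le> t'") (simp_all add: path_sigma_sets(2))
    then show ?thesis
      unfolding stopping_time_plus_def
      by (intro conjI ballI allI impI) (use r in \<open>simp only: zero_ereal_def ereal_less_eq\<close>)
  qed
  have se: "A \<in> stopped_events M Z (\<lambda>_. ereal r)"
  proof -
    have "{w \<in> A. ereal r \<le> ereal t'} \<in> sets (path_sigma M Z u)" if "0 \<le> t'" "t' < u" for t' u
    proof (cases "r \<le> t'")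
      case True
      then have "r \<le> u" using that by simp
      then have "A \<in> sets (path_sigma M Z u)"
        using path_sigma_mono A(1) by blast
      then show ?thesis using True by simp
    qed simp
    then show ?thesis
      unfolding stopped_events_def using AM by blast
  qed
  have Zr [measurable]: "(\<lambda>w. real_of_ereal (Z r w)) \<in> borel_measurable (P x)"
    using r by measurable
  have inner: "(\<lambda>w. \<integral>\<^sup>+w'. g (Z t w') \<partial>P (real_of_ereal (Z r w))) \<in> borel_measurable (P x)"
    if "g \<in> borel_measurable borel" for g :: "ereal \<Rightarrow> ennreal"
    using measurable_compose[OF Zr measurable_nn_transition[OF that t]] .
  have rt: "Z (r + t) \<in> borel_measurable (P x)"
    using r t by (intro measurable_Z_P) simp
  have left: "(\<lambda>w. indicator A w * g (Z (r + t) w)) \<in> borel_measurable (P x)"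
    if "g \<in> borel_measurable borel" for g :: "ereal \<Rightarrow> ennreal"
    by (intro borel_measurable_times_ennreal borel_measurable_indicator AP measurable_compose[OF rt that])
  have right: "(\<lambda>w. indicator A w * (\<integral>\<^sup>+w'. g (Z t w') \<partial>P (real_of_ereal (Z r w)))) \<in> borel_measurable (P x)"
    if "g \<in> borel_measurable borel" for g :: "ereal \<Rightarrow> ennreal"
    by (intro borel_measurable_times_ennreal borel_measurable_indicator AP inner that)
  have start_meas: "(\<lambda>w'. g (Z t w')) \<in> borel_measurable (P y)"
    if "g \<in> borel_measurable borel" for g :: "ereal \<Rightarrow> ennreal" and y
    using measurable_compose[OF measurable_Z_P[OF t] that] .
  from f show ?thesis
  proof (induct rule: borel_measurable_induct)
    case (cong f g)
    then show ?case by simp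
  next
    case (set B)
    have [measurable]: "B \<in> sets borel" by fact
    let ?p = "\<lambda>w. measure (P (real_of_ereal (Z r w))) {w' \<in> space M. Z t w' \<in> B}"
    have p: "?p \<in> borel_measurable (P x)"
      using measurable_compose[OF Zr measurable_transition[OF t set]] .
    have tr: "(\<integral>\<^sup>+w'. indicator B (Z t w') \<partial>P y) = ennreal (measure (P y) {w' \<in> space M. Z t w' \<in> B})" for y
    proof -
      have [measurable]: "{w \<in> space M. Z t w \<in> B} \<in> sets (P y)"
        using measurable_sets[OF measurable_Z[OF t] set] by (simp add: sets_P vimage_def Int_def conj_commute)
      have "(\<integral>\<^sup>+w. indicator B (Z t w) \<partial>P y) = (\<integral>\<^sup>+w. indicator {w \<in> space M. Z t w \<in> B} w \<partial>P y)"
        by (intro nn_integral_cong) (auto split: split_indicator)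
      then show ?thesis
        by (simp add: emeasure_P)
    qed
    have AB: "{w \<in> A. Z (r + t) w \<in> B} \<in> sets (P x)"
    proof -
      have "{w \<in> A. Z (r + t) w \<in> B} = A \<inter> (Z (r + t) -` B \<inter> space (P x))"
        using AS by auto
      moreover have "A \<inter> (Z (r + t) -` B \<inter> space (P x)) \<in> sets (P x)"
        by (rule sets.Int[OF AP measurable_sets[OF rt set]])
      ultimately show ?thesis by (simp only:)
    qed
    have "(\<integral>\<^sup>+w. indicator A w * indicator B (Z (r + t) w) \<partial>P x) =
        (\<integral>\<^sup>+w. indicator {w \<in> A. Z (r + t) w \<in> B} w \<partial>P x)"
      by (intro nn_integral_cong) (simp add: indicator_def)
    also have "\<dots> = ennreal (measure (P x) {w \<in> A. Z (r + t) w \<in> B})"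
      unfolding nn_integral_indicator[OF AB] by (rule emeasure_P)
    also have "measure (P x) {w \<in> A. Z (r + t) w \<in> B} = (\<integral>w. indicator A w * ?p w \<partial>P x)"
    proof -
      \<comment> \<open>On \<open>A\<close> the process has not yet exploded, so the restriction to
        finite positions in the strong Markov assumption removes nothing.\<close>
      have "A = {w \<in> A. ereal r < \<infinity> \<and> \<bar>Z (real_of_ereal (ereal r)) w\<bar> \<noteq> \<infinity>}"
      proof (rule Set.set_eqI)
        fix w
        have "ereal r < \<infinity>" by simp
        then show "w \<in> A \<longleftrightarrow> w \<in> {w \<in> A. ereal r < \<infinity> \<and> \<bar>Z (real_of_ereal (ereal r)) w\<bar> \<noteq> \<infinity>}"
          using A(2)[of w] by (cases "w \<in> A") (simp_all only: mem_Collect_eq real_of_ereal.simps simp_thms)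
      qed
      from strong_markov[OF st se t set this, of x] show ?thesis
        by (simp only: real_of_ereal.simps)
    qed
    also have "ennreal \<dots> = (\<integral>\<^sup>+w. ennreal (indicator A w * ?p w) \<partial>P x)"
    proof (rule nn_integral_eq_integral[symmetric])
      interpret prob_space "P x" by (rule prob_space_P)
      show "integrable (P x) (\<lambda>w. indicator A w * ?p w)"
        using p prob_space.prob_le_1[OF prob_space_P]
        by (intro integrable_const_bound[where B=1]) (auto split: split_indicator)
    qed simp
    also have "\<dots> = (\<integral>\<^sup>+w. indicator A w * (\<integral>\<^sup>+w'. indicator B (Z t w') \<partial>P (real_of_ereal (Z r w))) \<partial>P x)"
      unfolding tr by (intro nn_integral_cong) (auto split: split_indicator)
    finally show ?case .
  next
    case (mult u c)
    have "(\<integral>\<^sup>+w. indicator A w * (c * u (Z (r + t) w)) \<partial>P x) = c * (\<integral>\<^sup>+w. indicator A w * u (Z (r + t) w) \<partial>P x)"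
      unfolding mult.left_commute[of _ c] by (rule nn_integral_cmult[OF left[OF mult(2)]])
    also have "\<dots> = c * (\<integral>\<^sup>+w. indicator A w * (\<integral>\<^sup>+w'. u (Z t w') \<partial>P (real_of_ereal (Z r w))) \<partial>P x)"
      by (simp only: mult(4))
    also have "\<dots> = (\<integral>\<^sup>+w. indicator A w * (\<integral>\<^sup>+w'. c * u (Z t w') \<partial>P (real_of_ereal (Z r w))) \<partial>P x)"
      unfolding nn_integral_cmult[OF start_meas[OF mult(2)]] mult.left_commute[of _ c]
      by (rule nn_integral_cmult[OF right[OF mult(2)], symmetric])
    finally show ?case .
  next
    case (add u v)
    have "(\<integral>\<^sup>+w. indicator A w * (v (Z (r + t) w) + u (Z (r + t) w)) \<partial>P x) =
        (\<integral>\<^sup>+w. indicator A w * v (Z (r + t) w) \<partial>P x) + (\<integral>\<^sup>+w. indicator A w * u (Z (r + t) w) \<partial>P x)"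
      unfolding distrib_left by (rule nn_integral_add[OF left[OF add(4)] left[OF add(1)]])
    also have "\<dots> = (\<integral>\<^sup>+w. indicator A w * (\<integral>\<^sup>+w'. v (Z t w') \<partial>P (real_of_ereal (Z r w))) \<partial>P x) +
        (\<integral>\<^sup>+w. indicator A w * (\<integral>\<^sup>+w'. u (Z t w') \<partial>P (real_of_ereal (Z r w))) \<partial>P x)"
      by (simp only: add(3) add(7))
    also have "\<dots> = (\<integral>\<^sup>+w. indicator A w * (\<integral>\<^sup>+w'. v (Z t w') + u (Z t w') \<partial>P (real_of_ereal (Z r w))) \<partial>P x)"
      unfolding nn_integral_add[OF start_meas[OF add(4)] start_meas[OF add(1)]] distrib_left
      by (rule nn_integral_add[OF right[OF add(4)] right[OF add(1)], symmetric])
    finally show ?case .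
  next
    case (seq U)
    have mono: "U i z \<le> U j z" if "i \<le> j" for i j z
      using incseqD[OF seq(4) that] by (rule le_funD)
    have "(\<integral>\<^sup>+w. indicator A w * (\<Squnion> range U) (Z (r + t) w) \<partial>P x) =
        (\<integral>\<^sup>+w. (SUP i. indicator A w * U i (Z (r + t) w)) \<partial>P x)"
      by (simp only: SUP_mult_left_ennreal SUP_apply)
    also have "\<dots> = (SUP i. \<integral>\<^sup>+w. indicator A w * U i (Z (r + t) w) \<partial>P x)"
      by (intro nn_integral_monotone_convergence_SUP left seq(1) incseq_SucI le_funI mult_left_mono mono) simp_all
    also have "\<dots> = (SUP i. \<integral>\<^sup>+w. indicator A w * (\<integral>\<^sup>+w'. U i (Z t w') \<partial>P (real_of_ereal (Z r w))) \<partial>P x)"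
      by (simp only: seq(3))
    also have "\<dots> = (\<integral>\<^sup>+w. (SUP i. indicator A w * (\<integral>\<^sup>+w'. U i (Z t w') \<partial>P (real_of_ereal (Z r w)))) \<partial>P x)"
      by (intro nn_integral_monotone_convergence_SUP[symmetric] right seq(1) incseq_SucI le_funI
          mult_left_mono nn_integral_mono mono) simp_all
    also have "\<dots> = (\<integral>\<^sup>+w. indicator A w * (\<integral>\<^sup>+w'. (SUP i. U i (Z t w')) \<partial>P (real_of_ereal (Z r w))) \<partial>P x)"
    proof -
      have "(\<integral>\<^sup>+w'. (SUP i. U i (Z t w')) \<partial>P y) = (SUP i. \<integral>\<^sup>+w'. U i (Z t w') \<partial>P y)" for y
        by (intro nn_integral_monotone_convergence_SUP start_meas seq(1) incseq_SucI le_funI mono) simp_all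
      then show ?thesis
        by (simp only: SUP_mult_left_ennreal)
    qed
    finally show ?case
      by (simp only: SUP_apply)
  qed
qed

lemma kill_measurable [measurable]:
  fixes h :: "real \<Rightarrow> real"
  assumes [measurable]: "h \<in> borel_measurable borel"
  shows "kill h \<in> borel_measurable borel"
  unfolding kill_def by measurable

section \<open>Optional stopping on time grids and the order of hitting times\<close>

text \<open>Given \<open>Z r = y\<close> in \<open>D\<close>, the Markov property makes
  \<open>semigroup_op P Z t h y\<close> the mean of \<open>h\<close> after a further time
  \<open>t\<close>, and this exceeds \<open>h y\<close> by at least \<open>d\<close>; integrate over
  \<open>A\<close>. Boundedness of \<open>h\<close> permits the passage to nonnegative integrals and
  back.\<close>

lemma submartingale_step:
  fixes h :: "real \<Rightarrow> real"
  assumes h: "h \<in> borel_measurable borel" "\<And>y. 0 \<le> h y" "\<And>y. h y \<le> H"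
    and r: "0 \<le> r" and t: "0 \<le> t" and d: "0 \<le> d"
    and A: "A \<in> sets (path_sigma M Z r)" "\<And>w. w \<in> A \<Longrightarrow> \<exists>y\<in>D. Z r w = ereal y"
    and drift: "\<And>y. y \<in> D \<Longrightarrow> h y + d \<le> semigroup_op P Z t h y"
  shows "(\<integral>w. indicator A w * kill h (Z r w) \<partial>P x) + d * measure (P x) A
    \<le> (\<integral>w. indicator A w * kill h (Z (r + t) w) \<partial>P x)"
proof -
  have [measurable]: "A \<in> sets (P y)" for y
    using A path_sigma_subset sets_P by blast
  have AI: "A \<inter> space M = A"
    using A path_sigma_subset sets.sets_into_space by blast
  have kb: "0 \<le> kill h z" "kill h z \<le> H" for z
    using h(2,3) order_trans[OF h(2) h(3)] by (auto simp: kill_def)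
  have km [measurable]: "(\<lambda>w. kill h (Z u w)) \<in> borel_measurable (P y)" if "0 \<le> u" for u y
    using that h(1) by measurable
  have int: "integrable (P y) (\<lambda>w. kill h (Z u w))"
    "integrable (P y) (\<lambda>w. indicator A w * kill h (Z u w))" if "0 \<le> u" for u y
  proof -
    interpret prob_space "P y" by (rule prob_space_P)
    show "integrable (P y) (\<lambda>w. kill h (Z u w))" "integrable (P y) (\<lambda>w. indicator A w * kill h (Z u w))"
      using km[OF that] kb by (auto intro!: integrable_const_bound[where B=H] AE_I2
          order_trans[OF kb(1) kb(2)] split: split_indicator)
  qed
  interpret prob_space "P x" by (rule prob_space_P)
  have kE: "(\<lambda>z. ennreal (kill h z)) \<in> borel_measurable borel"
    using h(1) by measurable
  have "ennreal ((\<integral>w. indicator A w * kill h (Z r w) \<partial>P x) + d * prob A) =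
      ennreal (\<integral>w. indicator A w * kill h (Z r w) + indicator A w * d \<partial>P x)"
    using int(2)[OF r, of x] by (subst Bochner_Integration.integral_add)
      (auto simp: mult.commute emeasure_eq_measure AI)
  also have "\<dots> = (\<integral>\<^sup>+w. ennreal (indicator A w * kill h (Z r w) + indicator A w * d) \<partial>P x)"
  proof (rule nn_integral_eq_integral[symmetric])
    show "integrable (P x) (\<lambda>w. indicator A w * kill h (Z r w) + indicator A w * d)"
      by (intro Bochner_Integration.integrable_add int(2)[OF r] integrable_mult_left)
        (simp add: emeasure_eq_measure)
  qed (use kb d in auto)
  also have "\<dots> \<le> (\<integral>\<^sup>+w. indicator A w * (\<integral>\<^sup>+w'. ennreal (kill h (Z t w')) \<partial>P (real_of_ereal (Z r w))) \<partial>P x)"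
  proof (intro nn_integral_mono)
    fix w
    show "ennreal (indicator A w * kill h (Z r w) + indicator A w * d) \<le>
      indicator A w * (\<integral>\<^sup>+w'. ennreal (kill h (Z t w')) \<partial>P (real_of_ereal (Z r w)))"
    proof (cases "w \<in> A")
      case True
      then obtain y where y: "y \<in> D" "Z r w = ereal y"
        using A(2) by blast
      have "(\<integral>\<^sup>+w'. ennreal (kill h (Z t w')) \<partial>P y) = ennreal (semigroup_op P Z t h y)"
        unfolding semigroup_op_def using int(1)[OF t] kb by (intro nn_integral_eq_integral) auto
      then show ?thesis
        using drift[OF y(1)] True y(2) by (simp add: kill_def ennreal_leI)
    qed simp
  qed
  also have "\<dots> = (\<integral>\<^sup>+w. indicator A w * ennreal (kill h (Z (r + t) w)) \<partial>P x)"
    by (intro simple_markov_nn[OF kE r t A(1), symmetric]) (use A(2) in force)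
  also have "\<dots> = (\<integral>\<^sup>+w. ennreal (indicator A w * kill h (Z (r + t) w)) \<partial>P x)"
    by (intro nn_integral_cong) (auto split: split_indicator)
  also have "\<dots> = ennreal (\<integral>w. indicator A w * kill h (Z (r + t) w) \<partial>P x)"
    using int(2)[of "r + t" x] r t kb by (intro nn_integral_eq_integral) auto
  finally show ?thesis
    using kb by (subst (asm) ennreal_le_iff) (auto intro!: Bochner_Integration.integral_nonneg)
qed

text \<open>
  Optional stopping for the process observed at the times \<open>j * t\<close> until it leaves \<open>(\<epsilon>, b)\<close>.
  The strict drift \<open>d\<close> is what makes the exit time finite.
\<close>

lemma grid_exit_bound:
  fixes h :: "real \<Rightarrow> real"
  assumes h: "h \<in> borel_measurable borel" "\<And>y. 0 \<le> h y" "\<And>y. h y \<le> H"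
    and low: "\<And>y. y \<le> \<epsilon> \<Longrightarrow> h y \<le> h \<epsilon>"
    and t: "0 < t" and d: "0 < d" and x: "\<epsilon> < x" "x < b"
    and drift: "\<And>y. y \<in> {\<epsilon><..<b} \<Longrightarrow> h y + d \<le> semigroup_op P Z t h y"
  defines "U \<equiv> {w \<in> space M. \<exists>k::nat. (\<forall>j\<le>k. Z (real j * t) w \<in> {ereal \<epsilon><..<ereal b}) \<and>
      ereal b \<le> Z (real (Suc k) * t) w}"
  shows "U \<in> sets M" and "h x \<le> h \<epsilon> + H * measure (P x) U"
proof -
  interpret prob_space "P x" by (rule prob_space_P)
  \<comment> \<open>\<open>A k\<close> means no exit up to step \<open>k\<close>; \<open>V k\<close>
    and \<open>W k\<close> are the exits through the top and the bottom at step
    \<open>k + 1\<close>. Explosion to either infinity counts as an exit through the corresponding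
    end.\<close>
  define A where "A k = {w \<in> space M. \<forall>j\<le>k. Z (real j * t) w \<in> {ereal \<epsilon><..<ereal b}}" for k :: nat
  define V where "V k = A k \<inter> {w \<in> space M. ereal b \<le> Z (real (Suc k) * t) w}" for k
  define W where "W k = A k \<inter> {w \<in> space M. Z (real (Suc k) * t) w \<le> ereal \<epsilon>}" for k
  have A_sigma: "A k \<in> sets (path_sigma M Z (real k * t))" for k
  proof -
    let ?S = "path_sigma M Z (real k * t)"
    have "(\<Inter>j\<in>{..k}. Z (real j * t) -` {ereal \<epsilon><..<ereal b} \<inter> space ?S) \<in> sets ?S"
      using t by (intro sets.finite_INT measurable_sets[OF measurable_path_sigma]) (auto intro: mult_right_mono)
    also have "(\<Inter>j\<in>{..k}. Z (real j * t) -` {ereal \<epsilon><..<ereal b} \<inter> space ?S) = A k"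
      by (auto simp: A_def path_sigma_sets(2))
    finally show ?thesis .
  qed
  have AM: "A k \<in> sets M" for k
    using A_sigma path_sigma_subset by blast
  have ZM: "{w \<in> space M. ereal b \<le> Z (real (Suc k) * t) w} \<in> sets M"
    "{w \<in> space M. Z (real (Suc k) * t) w \<le> ereal \<epsilon>} \<in> sets M" for k
  proof -
    have m: "Z (real (Suc k) * t) \<in> borel_measurable M"
      using t by (intro measurable_Z) simp
    show "{w \<in> space M. ereal b \<le> Z (real (Suc k) * t) w} \<in> sets M"
      using measurable_sets[OF m, of "{ereal b..}"] by (simp add: vimage_def Int_def conj_commute)
    show "{w \<in> space M. Z (real (Suc k) * t) w \<le> ereal \<epsilon>} \<in> sets M"
      using measurable_sets[OF m, of "{..ereal \<epsilon>}"] by (simp add: vimage_def Int_def conj_commute)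
  qed
  have VM: "V k \<in> sets M" and WM: "W k \<in> sets M" for k
    unfolding V_def W_def by (intro sets.Int AM ZM)+
  have ev: "A k \<in> events" "V k \<in> events" "W k \<in> events" for k
    using AM VM WM by (simp_all only: sets_P)
  have U_eq: "U = (\<Union>k. V k)"
    unfolding U_def V_def A_def by auto
  show "U \<in> sets M"
    unfolding U_eq by (intro sets.countable_UN image_subsetI VM)
  have A_Suc: "w \<in> A k \<longleftrightarrow> w \<in> A (Suc k) \<or> w \<in> V k \<or> w \<in> W k"
    and disj: "\<not> (w \<in> A (Suc k) \<and> w \<in> V k)" "\<not> (w \<in> A (Suc k) \<and> w \<in> W k)" "\<not> (w \<in> V k \<and> w \<in> W k)" for w k
  proof -
    have *: "w \<in> A (Suc k) \<longleftrightarrow> w \<in> A k \<and> Z (real (Suc k) * t) w \<in> {ereal \<epsilon><..<ereal b}" for w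
      unfolding A_def by (auto simp: le_Suc_eq)
    show "w \<in> A k \<longleftrightarrow> w \<in> A (Suc k) \<or> w \<in> V k \<or> w \<in> W k"
      unfolding * V_def W_def by (auto simp: A_def not_less)
    have "\<not> (ereal b \<le> z \<and> z \<le> ereal \<epsilon>)" for z
      using x by (cases z) auto
    then show "\<not> (w \<in> A (Suc k) \<and> w \<in> V k)" "\<not> (w \<in> A (Suc k) \<and> w \<in> W k)" "\<not> (w \<in> V k \<and> w \<in> W k)"
      unfolding * V_def W_def by auto
  qed
  have A_mono: "A (Suc k) \<subseteq> A k" for k
    using A_Suc by blast
  have A_anti: "A j \<subseteq> A k" if "k \<le> j" for j k
    using that by (rule lift_Suc_antimono_le[of A, OF A_mono])
  have kb: "0 \<le> kill h z" "kill h z \<le> H" for z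
    using h(2,3) order_trans[OF h(2) h(3)] by (auto simp: kill_def)
  \<comment> \<open>At the cemetery point below, the extended function is 0, which is at most
    \<open>h \<epsilon>\<close> because \<open>h\<close> is nonnegative.\<close>
  have klow: "kill h z \<le> h \<epsilon>" if "z \<le> ereal \<epsilon>" for z
    using that low h(2)[of \<epsilon>] by (cases z) (auto simp: kill_def)
  define e where "e k = (\<integral>w. indicator (A k) w * kill h (Z (real k * t) w) \<partial>P x)" for k
  have H0: "0 \<le> H" using order_trans[OF h(2) h(3)] .
  have km: "(\<lambda>w. kill h (Z u w)) \<in> borel_measurable (P x)" if "0 \<le> u" for u
    using measurable_compose[OF measurable_Z_P[OF that] kill_measurable[OF h(1)]] .
  have int: "integrable (P x) (\<lambda>w. indicator B w * kill h (Z u w))" if "0 \<le> u" "B \<in> events" for u B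
  proof (rule integrable_const_bound[where B=H])
    show "(\<lambda>w. indicator B w * kill h (Z u w)) \<in> borel_measurable (P x)"
      by (intro borel_measurable_times borel_measurable_indicator km that)
    show "AE w in P x. norm (indicator B w * kill h (Z u w)) \<le> H"
      using kb H0 by (intro AE_I2) (simp add: indicator_def)
  qed
  have ind: "integrable (P x) (\<lambda>w. c * indicator B w :: real)" "(\<integral>w. c * indicator B w \<partial>P x) = c * prob B" if "B \<in> events" for c B
    using that sets.sets_into_space[OF that] by (auto simp: emeasure_eq_measure Int_absorb2)
  \<comment> \<open>Of the mass inside, what stays is carried to \<open>e (Suc k)\<close>; an exit
    upward is charged the maximum \<open>H\<close>, an exit downward only
    \<open>h \<epsilon>\<close>.\<close>
  have step: "e k + d * prob (A k) \<le> e (Suc k) + H * prob (V k) + h \<epsilon> * prob (W k)" for k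
  proof -
    have "e k + d * prob (A k) \<le> (\<integral>w. indicator (A k) w * kill h (Z (real k * t + t) w) \<partial>P x)"
      unfolding e_def
    proof (rule submartingale_step[OF h _ _ _ A_sigma _ drift])
      show "\<exists>y\<in>{\<epsilon><..<b}. Z (real k * t) w = ereal y" if "w \<in> A k" for w
        using that by (cases "Z (real k * t) w") (auto simp: A_def)
    qed (use t d in auto)
    also have "real k * t + t = real (Suc k) * t"
      by (simp add: algebra_simps)
    also have "(\<integral>w. indicator (A k) w * kill h (Z (real (Suc k) * t) w) \<partial>P x) \<le>
      (\<integral>w. indicator (A (Suc k)) w * kill h (Z (real (Suc k) * t) w) + H * indicator (V k) w + h \<epsilon> * indicator (W k) w \<partial>P x)"
    proof (rule integral_mono)
      show "integrable (P x) (\<lambda>w. indicator (A k) w * kill h (Z (real (Suc k) * t) w))"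
        using t by (intro int ev) simp
      show "integrable (P x) (\<lambda>w. indicator (A (Suc k)) w * kill h (Z (real (Suc k) * t) w) + H * indicator (V k) w + h \<epsilon> * indicator (W k) w)"
        using t by (intro Bochner_Integration.integrable_add int ind ev) simp
      fix w
      show "indicator (A k) w * kill h (Z (real (Suc k) * t) w) \<le>
        indicator (A (Suc k)) w * kill h (Z (real (Suc k) * t) w) + H * indicator (V k) w + h \<epsilon> * indicator (W k) w"
      proof (cases "w \<in> W k")
        case True
        then have "kill h (Z (real (Suc k) * t) w) \<le> h \<epsilon>"
          by (intro klow) (simp add: W_def)
        then show ?thesis
          using True A_Suc[of w k] disj[of w k] by (simp add: indicator_def)
      next
        case False
        then show ?thesis
          using A_Suc[of w k] disj[of w k] kb by (simp add: indicator_def)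
      qed
    qed
    also have "\<dots> = e (Suc k) + H * prob (V k) + h \<epsilon> * prob (W k)"
    proof -
      have i: "integrable (P x) (\<lambda>w. indicator (A (Suc k)) w * kill h (Z (real (Suc k) * t) w))"
        using t by (intro int ev) simp
      show ?thesis
        unfolding e_def
        using Bochner_Integration.integral_add[OF Bochner_Integration.integrable_add[OF i ind(1)[OF ev(2)]] ind(1)[OF ev(3)]]
          Bochner_Integration.integral_add[OF i ind(1)[OF ev(2)]] ind(2)[OF ev(2)] ind(2)[OF ev(3)] by metis
    qed
    finally show ?thesis .
  qed
  have pA: "prob (A k) = prob (A (Suc k)) + prob (V k) + prob (W k)" for k
  proof -
    have "A k = A (Suc k) \<union> (V k \<union> W k)"
      using A_Suc by blast
    moreover have "A (Suc k) \<inter> (V k \<union> W k) = {}" "V k \<inter> W k = {}"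
      using disj by blast+
    ultimately show ?thesis
      using finite_measure_Union[of "A (Suc k)" "V k \<union> W k"] finite_measure_Union[of "V k" "W k"] ev
      by (simp only: sets.Un add.assoc)
  qed
  have sumA: "e 0 + d * (\<Sum>k<K. prob (A k)) \<le> e K + H * (\<Sum>k<K. prob (V k)) + h \<epsilon> * (\<Sum>k<K. prob (W k))" for K
  proof (induction K)
    case (Suc K)
    then show ?case using step[of K] by (simp add: distrib_left)
  qed simp
  have disjV: "disjoint_family V"
  proof -
    have "V i \<inter> V j = {}" if "i < j" for i j
    proof -
      have "V j \<subseteq> A j" "A j \<subseteq> A (Suc i)"
        using A_anti[of "Suc i" j] that by (auto simp: V_def)
      then show ?thesis using disj(1)[of _ i] by blast
    qed
    then show ?thesis
      unfolding disjoint_family_on_def by (metis Int_commute linorder_neqE_nat)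
  qed
  have sumV: "(\<Sum>k<K. prob (V k)) \<le> prob U" for K
  proof -
    have "(\<Sum>k<K. prob (V k)) = prob (\<Union>k\<in>{..<K}. V k)"
      using disjV ev by (intro finite_measure_finite_Union[symmetric] image_subsetI disjoint_family_on_mono[OF _ disjV]) auto
    also have "\<dots> \<le> prob U"
      unfolding U_eq using ev by (intro finite_measure_mono sets.countable_UN image_subsetI) auto
    finally show ?thesis .
  qed
  have sumW: "(\<Sum>k<K. prob (W k)) \<le> 1" for K
  proof -
    have "(\<Sum>k<K. prob (W k)) \<le> prob (A 0) - prob (A K)"
    proof (induction K)
      case (Suc K)
      have "0 \<le> prob (V K)" by (rule measure_nonneg)
      then show ?case
        using Suc pA[of K] unfolding sum.lessThan_Suc by linarith
    qed simp
    then show ?thesis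
      using prob_le_1[of "A 0"] measure_nonneg[of "P x" "A K"] by linarith
  qed
  have eb: "0 \<le> e k" "e k \<le> H * prob (A k)" for k
  proof -
    show "0 \<le> e k"
      unfolding e_def using kb by (intro Bochner_Integration.integral_nonneg) simp
    have "e k \<le> (\<integral>w. H * indicator (A k) w \<partial>P x)"
      unfolding e_def using t kb by (intro integral_mono int ind ev) (simp_all add: indicator_def)
    then show "e k \<le> H * prob (A k)"
      using ind(2)[OF ev(1)] by metis
  qed
  have h0: "0 \<le> h \<epsilon>" by (rule h)
  have bound: "e 0 + d * (\<Sum>k<K. prob (A k)) \<le> H * prob (A K) + H * prob U + h \<epsilon>" for K
    using sumA[of K] eb(2)[of K] mult_left_mono[OF sumV[of K] H0] mult_left_mono[OF sumW[of K] h0] by linarith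
  \<comment> \<open>The accumulated drift is bounded by the bounded function \<open>h\<close>, so
    the expected number of steps inside is finite and the remainder \<open>H * prob (A K)\<close>
    vanishes in the limit.\<close>
  have "summable (\<lambda>k. prob (A k))"
  proof (rule summableI_nonneg_bounded)
    fix K
    have "d * (\<Sum>k<K. prob (A k)) \<le> H * 1 + H * prob U + h \<epsilon>"
      using bound[of K] eb(1)[of 0] mult_left_mono[OF prob_le_1[of "A K"] H0] by linarith
    then show "(\<Sum>k<K. prob (A k)) \<le> (H * 1 + H * prob U + h \<epsilon>) / d"
      using d by (simp add: pos_le_divide_eq mult.commute)
  qed simp
  then have "(\<lambda>K. prob (A K)) \<longlonglongrightarrow> 0"
    by (rule summable_LIMSEQ_zero)
  then have "(\<lambda>K. H * prob (A K) + H * prob U + h \<epsilon>) \<longlonglongrightarrow> H * 0 + H * prob U + h \<epsilon>"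
    by (intro tendsto_intros)
  moreover have "e 0 \<le> H * prob (A K) + H * prob U + h \<epsilon>" for K
  proof -
    have "0 \<le> d * (\<Sum>k<K. prob (A k))"
      using d by (intro mult_nonneg_nonneg sum_nonneg) auto
    then show ?thesis using bound[of K] by linarith
  qed
  ultimately have "e 0 \<le> H * 0 + H * prob U + h \<epsilon>"
    by (intro LIMSEQ_le_const[of _ _ "e 0"]) auto
  moreover have "e 0 = h x"
  proof -
    have "AE w in P x. indicator (A 0) w * kill h (Z (real 0 * t) w) = h x"
      using start[of x] AE_space
    proof eventually_elim
      case (elim w)
      then have "w \<in> A 0"
        using x by (simp add: A_def)
      then show ?case
        using elim by (simp add: kill_def)
    qed
    then have "e 0 = (\<integral>w. h x \<partial>P x)"
      unfolding e_def using int[of 0 "A 0"] ev by (intro integral_cong_AE) auto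
    then show ?thesis using prob_space[unfolded space_P] by simp
  qed
  ultimately show "h x \<le> h \<epsilon> + H * prob U"
    by linarith
qed

text \<open>Let \<open>v\<close> be the first time at which the path is at least \<open>b\<close>.
  If the path were at or below \<open>a\<close> before \<open>v\<close>, continuity would keep it
  below \<epsilon> on a whole time interval; a fine enough grid has a point there, before its exit
  through the top, contradicting that all earlier grid values lie above \<epsilon>. The gap between
  \<open>a\<close> and \<epsilon> is what makes a short visit to \<open>a\<close> visible on the
  grid.\<close>

lemma grid_exit_imp_hitting:
  assumes w: "w \<in> space M" "Z 0 w = ereal x" and ord: "a < \<epsilon>" "\<epsilon> < x" "x < b"
    and inf: "\<exists>\<^sub>\<infinity>n. \<exists>k::nat. (\<forall>j\<le>k. Z (real j * (1 / real (Suc n))) w \<in> {ereal \<epsilon><..<ereal b}) \<and>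
      ereal b \<le> Z (real (Suc k) * (1 / real (Suc n))) w"
  shows "hitting_time Z b w < hitting_time Z a w"
proof -
  let ?g = "\<lambda>u. Z u w"
  have cont: "continuous_on {0..} ?g"
    using continuous_paths w by blast
  define T where "T = {0..} \<inter> ?g -` {ereal b..}"
  have "closed T"
    unfolding T_def by (intro continuous_closed_preimage cont) auto
  moreover have "T \<noteq> {}"
  proof -
    obtain n k where "ereal b \<le> Z (real (Suc k) * (1 / real (Suc n))) w"
      using inf[THEN frequently_ex] by auto
    then have "real (Suc k) * (1 / real (Suc n)) \<in> T"
      by (simp add: T_def)
    then show ?thesis by blast
  qed
  moreover have bdd: "bdd_below T" by (rule bdd_belowI[of _ 0]) (simp add: T_def)
  ultimately have vT: "Inf T \<in> T"
    by (intro closed_contains_Inf)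
  define v where "v = Inf T"
  have v: "0 \<le> v" "ereal b \<le> ?g v"
    using vT by (auto simp: T_def v_def)
  have before: "?g u < ereal b" if "0 \<le> u" "u < v" for u
  proof (rule ccontr)
    assume "\<not> ?g u < ereal b"
    then have "u \<in> T" using that by (simp add: T_def not_less)
    then have "v \<le> u" unfolding v_def using bdd by (rule cInf_lower)
    then show False using that by simp
  qed
  have v0: "0 < v"
    using v w ord by (cases "v = 0") auto
  have gv: "?g v = ereal b"
  proof -
    have "\<exists>u\<ge>0. u \<le> v \<and> ?g u = ereal b"
      using v w ord by (intro IVT' continuous_on_subset[OF cont]) auto
    then obtain u where "0 \<le> u" "u \<le> v" "?g u = ereal b" by blast
    then show ?thesis
      using before[of u] by (cases "u = v") auto
  qed
  have above: "ereal a < ?g u" if u: "0 \<le> u" "u \<le> v" for u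
  proof (rule ccontr)
    assume "\<not> ereal a < ?g u"
    then have gu: "?g u \<in> {..<ereal \<epsilon>}"
      using ord by (simp add: not_less) (meson ereal_less_ereal_Ex le_less_trans less_ereal.simps(1))
    then have uv: "u < v"
      using gv u ord by (cases "u = v") auto
    have "\<forall>\<^sub>F u' in at u within {0..}. ?g u' \<in> {..<ereal \<epsilon>}"
    proof (rule topological_tendstoD[OF _ _ gu])
      show "(?g \<longlongrightarrow> ?g u) (at u within {0..})"
        using cont u by (simp add: continuous_on_def)
    qed simp
    then obtain \<eta> where \<eta>: "0 < \<eta>" "\<And>u'. 0 \<le> u' \<Longrightarrow> u' \<noteq> u \<Longrightarrow> dist u' u < \<eta> \<Longrightarrow> ?g u' < ereal \<epsilon>"
      unfolding eventually_at by auto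
    obtain n0 where n0: "inverse (real (Suc n0)) < \<eta>"
      using reals_Archimedean[OF \<eta>(1)] by blast
    obtain n k where n: "n0 < n" and k: "\<forall>j\<le>k. Z (real j * (1 / real (Suc n))) w \<in> {ereal \<epsilon><..<ereal b}"
      "ereal b \<le> Z (real (Suc k) * (1 / real (Suc n))) w"
      using inf unfolding INFM_nat by blast
    \<comment> \<open>The last grid index whose time does not exceed \<open>u\<close>; the mesh is
      smaller than \<eta>, so this time lies in the interval where the path is below
      \<epsilon>.\<close>
    define j where "j = nat \<lfloor>u * real (Suc n)\<rfloor>"
    have j: "real j \<le> u * real (Suc n)" "u * real (Suc n) < real j + 1"
      using u by (auto simp: j_def)
    define u' where "u' = real j * (1 / real (Suc n))"
    have u': "u' \<le> u" "u < u' + 1 / real (Suc n)" "0 \<le> u'"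
      using j by (simp_all add: u'_def field_simps)
    have "1 / real (Suc n) \<le> inverse (real (Suc n0))"
      using n by (simp add: inverse_eq_divide frac_le)
    then have "\<bar>u' - u\<bar> < \<eta>"
      using u' n0 by linarith
    then have gu': "?g u' < ereal \<epsilon>"
      using \<eta>(2)[of u'] u' gu by (cases "u' = u") (auto simp: dist_real_def)
    \<comment> \<open>The grid exit happens at a time when the path is at least \<open>b\<close>,
      hence not before \<open>v\<close>; so \<open>u'\<close> is one of the grid times that must
      still be inside.\<close>
    have "v \<le> real (Suc k) * (1 / real (Suc n))"
      unfolding v_def using k(2) by (intro cInf_lower bdd) (simp add: T_def)
    then have "u' < real (Suc k) * (1 / real (Suc n))"
      using u' uv by linarith
    then have "j \<le> k"
      by (simp add: u'_def divide_less_cancel)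
    then have "ereal \<epsilon> < ?g u'"
      using k(1) by (simp add: u'_def)
    then show False using gu' by simp
  qed
  have "hitting_time Z b w \<le> ereal v"
    unfolding hitting_time_def using v0 gv by (intro Inf_lower) auto
  \<comment> \<open>A hitting time is an infimum, so avoiding \<open>a\<close> up to time
    \<open>v\<close> is not enough for strictness; continuity at \<open>v\<close> supplies an
    additional interval without visits to \<open>a\<close>.\<close>
  also have "ereal v < hitting_time Z a w"
  proof -
    have "?g v \<in> {ereal a<..}"
      using gv ord by simp
    then have "\<forall>\<^sub>F u' in at v within {0..}. ?g u' \<in> {ereal a<..}"
    proof (rule topological_tendstoD[rotated 2])
      show "(?g \<longlongrightarrow> ?g v) (at v within {0..})"
        using cont v by (simp add: continuous_on_def)
    qed simp
    then obtain \<eta> where \<eta>: "0 < \<eta>" "\<And>u'. 0 \<le> u' \<Longrightarrow> u' \<noteq> v \<Longrightarrow> dist u' v < \<eta> \<Longrightarrow> ereal a < ?g u'"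
      unfolding eventually_at by auto
    have "ereal (v + \<eta>) \<le> hitting_time Z a w"
      unfolding hitting_time_def
    proof (rule Inf_greatest)
      fix z assume "z \<in> {ereal t |t. 0 < t \<and> Z t w = ereal a}"
      then obtain t where t: "z = ereal t" "0 < t" "Z t w = ereal a" by blast
      have "v < t"
        using above[of t] t by (cases "t \<le> v") auto
      moreover have "\<not> t < v + \<eta>"
        using \<eta>(2)[of t] t \<open>v < t\<close> by (auto simp: dist_real_def)
      ultimately show "ereal (v + \<eta>) \<le> z"
        using t by simp
    qed
    moreover have "ereal v < ereal (v + \<eta>)"
      using \<eta> by simp
    ultimately show ?thesis by (rule less_le_trans[rotated])
  qed
  finally show ?thesis .
qed

end

text \<open>The bound holds for the upward exit \<open>U n\<close> on every fine grid. The tail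
  unions \<open>B m\<close> inherit it, continuity from above passes it to the event that infinitely
  many \<open>U n\<close> occur, and almost surely that event forces \<open>b\<close> to be hit
  before \<open>a\<close>. The drift is stated as \<open>\<delta> * t\<close> because each mesh
  needs its own positive gain per step.\<close>

lemma (in real_diffusion) hitting_probability_bound:
  fixes h :: "real \<Rightarrow> real"
  assumes h: "h \<in> borel_measurable borel" "\<And>y. 0 \<le> h y" "\<And>y. h y \<le> H"
    and low: "\<And>y. y \<le> \<epsilon> \<Longrightarrow> h y \<le> h \<epsilon>"
    and ord: "a < \<epsilon>" "\<epsilon> < x" "x < b"
    and \<delta>: "0 < \<delta>" "0 < t0"
    and drift: "\<And>t y. 0 < t \<Longrightarrow> t < t0 \<Longrightarrow> y \<in> {\<epsilon><..<b} \<Longrightarrow> h y + \<delta> * t \<le> semigroup_op P Z t h y"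
    and E: "{w \<in> space (P x). hitting_time Z b w < hitting_time Z a w} \<in> sets (P x)"
  shows "h x \<le> h \<epsilon> + H * measure (P x) {w \<in> space (P x). hitting_time Z b w < hitting_time Z a w}"
proof -
  interpret prob_space "P x" by (rule prob_space_P)
  have H0: "0 \<le> H" using order_trans[OF h(2) h(3)] .
  define U where "U n = {w \<in> space M. \<exists>k::nat. (\<forall>j\<le>k. Z (real j * (1 / real (Suc n))) w \<in> {ereal \<epsilon><..<ereal b}) \<and>
      ereal b \<le> Z (real (Suc k) * (1 / real (Suc n))) w}" for n
  obtain n0 where n0: "inverse (real (Suc n0)) < t0"
    using reals_Archimedean[OF \<delta>(2)] by blast
  define B where "B m = (\<Union>n\<in>{max m n0..}. U n)" for m
  have U: "U n \<in> events" "h x \<le> h \<epsilon> + H * prob (U n)" if "n0 \<le> n" for n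
  proof -
    have "1 / real (Suc n) \<le> inverse (real (Suc n0))"
      using that by (simp add: inverse_eq_divide frac_le)
    then have t: "0 < 1 / real (Suc n)" "1 / real (Suc n) < t0"
      using n0 by (simp, linarith)
    have d: "0 < \<delta> * (1 / real (Suc n))"
      using \<delta>(1) t(1) by (rule mult_pos_pos)
    note g = grid_exit_bound[OF h low t(1) d ord(2,3) drift[OF t], folded U_def]
    show "U n \<in> events" using g(1) by (simp only: sets_P)
    show "h x \<le> h \<epsilon> + H * prob (U n)" using g(2) .
  qed
  have B: "B m \<in> events" for m
    unfolding B_def using U(1) by (intro sets.countable_UN' countableI_type image_subsetI) auto
  have "h x \<le> h \<epsilon> + H * prob (B m)" for m
  proof -
    have "prob (U (max m n0)) \<le> prob (B m)"
      using B by (intro finite_measure_mono) (auto simp: B_def)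
    then show ?thesis
      using U(2)[of "max m n0"] mult_left_mono[OF _ H0] by fastforce
  qed
  moreover have "(\<lambda>m. h \<epsilon> + H * prob (B m)) \<longlonglongrightarrow> h \<epsilon> + H * prob (\<Inter>m. B m)"
  proof (intro tendsto_intros finite_Lim_measure_decseq)
    show "antimono B"
      unfolding B_def by (intro antimonoI UN_mono) auto
  qed (use B in blast)
  ultimately have 1: "h x \<le> h \<epsilon> + H * prob (\<Inter>m. B m)"
    by (intro LIMSEQ_le_const[of _ _ "h x"]) auto
  have "AE w in P x. w \<in> (\<Inter>m. B m) \<longrightarrow> w \<in> {w \<in> space (P x). hitting_time Z b w < hitting_time Z a w}"
    using start[of x] AE_space
  proof eventually_elim
    case (elim w)
    show ?case
    proof
      assume w: "w \<in> (\<Inter>m. B m)"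
      have "\<exists>\<^sub>\<infinity>n. w \<in> U n"
        unfolding INFM_nat_le
      proof
        fix m
        from w have "w \<in> B m" by blast
        then show "\<exists>n\<ge>m. w \<in> U n" by (auto simp: B_def)
      qed
      then have "\<exists>\<^sub>\<infinity>n. \<exists>k::nat. (\<forall>j\<le>k. Z (real j * (1 / real (Suc n))) w \<in> {ereal \<epsilon><..<ereal b}) \<and>
          ereal b \<le> Z (real (Suc k) * (1 / real (Suc n))) w"
        by (rule frequently_elim1) (simp only: U_def mem_Collect_eq)
      moreover have "w \<in> space M" using elim by simp
      ultimately show "w \<in> {w \<in> space (P x). hitting_time Z b w < hitting_time Z a w}"
        using grid_exit_imp_hitting[OF _ elim(1) ord] elim(2) by blast
    qed
  qed
  then have "prob (\<Inter>m. B m) \<le> prob {w \<in> space (P x). hitting_time Z b w < hitting_time Z a w}"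
    using E by (rule finite_measure_mono_AE)
  then have "H * prob (\<Inter>m. B m) \<le> H * prob {w \<in> space (P x). hitting_time Z b w < hitting_time Z a w}"
    using H0 by (rule mult_left_mono)
  with 1 show ?thesis by linarith
qed

section \<open>A compactly supported test function\<close>

lemma DERIV_positive_part_power:
  "((\<lambda>u::real. max 0 u ^ Suc (Suc n)) has_real_derivative real (Suc (Suc n)) * max 0 u ^ Suc n) (at u)"
proof -
  consider "u < 0" | "u = 0" | "0 < u" by linarith
  then show ?thesis
  proof cases
    case 1
    have "((\<lambda>u::real. 0) has_real_derivative 0) (at u)" by simp
    then have "((\<lambda>u::real. max 0 u ^ Suc (Suc n)) has_real_derivative 0) (at u)"
      by (rule has_field_derivative_transform_within_open[of _ _ _ "{..<0}"]) (use 1 in auto)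
    then show ?thesis using 1 by simp
  next
    case 2
    have "((\<lambda>y::real. \<bar>y\<bar> ^ Suc n) \<longlongrightarrow> \<bar>0\<bar> ^ Suc n) (at 0)"
      by (intro tendsto_intros)
    then have l: "((\<lambda>y::real. \<bar>y\<bar> ^ Suc n) \<longlongrightarrow> 0) (at 0)" by simp
    have "((\<lambda>y::real. (max 0 y ^ Suc (Suc n) - max 0 0 ^ Suc (Suc n)) / (y - 0)) \<longlongrightarrow> 0) (at 0)"
    proof (rule Lim_null_comparison[OF always_eventually l], rule allI)
      fix y :: real
      show "norm ((max 0 y ^ Suc (Suc n) - max 0 0 ^ Suc (Suc n)) / (y - 0)) \<le> \<bar>y\<bar> ^ Suc n"
      proof (cases "0 < y")
        case True
        then show ?thesis by (simp add: abs_mult)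
      next
        case False
        then have "max 0 y = 0" by simp
        then have "norm ((max 0 y ^ Suc (Suc n) - max 0 0 ^ Suc (Suc n)) / (y - 0)) = 0"
          by simp
        then show ?thesis by (simp only: zero_le_power abs_ge_zero)
      qed
    qed
    then show ?thesis
      using 2 by (simp add: has_field_derivative_iff)
  next
    case 3
    have "((\<lambda>u::real. u ^ Suc (Suc n)) has_real_derivative real (Suc (Suc n)) * u ^ Suc n) (at u)"
      by (rule derivative_eq_intros refl | simp)+
    then have "((\<lambda>u::real. max 0 u ^ Suc (Suc n)) has_real_derivative real (Suc (Suc n)) * u ^ Suc n) (at u)"
      by (rule has_field_derivative_transform_within_open[of _ _ _ "{0<..}"]) (use 3 in auto)
    then show ?thesis using 3 by simp
  qed
qed

text \<open>A concave parabola with value \<open>q\<close> at 0 and vertex at 1, cut off at zero and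
  cubed so that it stays twice continuously differentiable across the cut. For small
  \<open>q\<close> its curvature at 0 is of order \<open>q\<close> and positive, while its slope is
  of order \<open>q\<close> squared, so the second-order term of the generator wins over the drift
  \<open>c 0\<close> of unknown sign.\<close>

definition bump :: "real \<Rightarrow> real \<Rightarrow> real" where
  "bump q x = max 0 (q + 1 - (x - 1)\<^sup>2) ^ 3"

lemma bump_deriv:
  "(bump q has_real_derivative - 6 * (x - 1) * max 0 (q + 1 - (x - 1)\<^sup>2) ^ 2) (at x)"
proof -
  have "((\<lambda>x. q + 1 - (x - 1)\<^sup>2) has_real_derivative - 2 * (x - 1)) (at x)"
    by (auto intro!: derivative_eq_intros)
  from DERIV_chain2[OF DERIV_positive_part_power[of 1] this] show ?thesis
    by (simp add: bump_def[abs_def] numeral_3_eq_3 numeral_2_eq_2 algebra_simps)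
qed

lemma bump_deriv2:
  "((\<lambda>x. - 6 * (x - 1) * max 0 (q + 1 - (x - 1)\<^sup>2) ^ 2) has_real_derivative
    - 6 * max 0 (q + 1 - (x - 1)\<^sup>2) ^ 2 + 24 * (x - 1)\<^sup>2 * max 0 (q + 1 - (x - 1)\<^sup>2)) (at x)"
proof -
  let ?\<psi> = "\<lambda>x. q + 1 - (x - 1)\<^sup>2"
  have "(?\<psi> has_real_derivative - 2 * (x - 1)) (at x)"
    by (auto intro!: derivative_eq_intros)
  from DERIV_chain2[OF DERIV_positive_part_power[of 0] this]
  have "((\<lambda>x. max 0 (?\<psi> x) ^ 2) has_real_derivative 2 * max 0 (?\<psi> x) * (- 2 * (x - 1))) (at x)"
    by (simp add: numeral_2_eq_2)
  moreover have "((\<lambda>x. - 6 * (x - 1)) has_real_derivative - 6) (at x)"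
    by (auto intro!: derivative_eq_intros)
  ultimately have "((\<lambda>x. - 6 * (x - 1) * max 0 (?\<psi> x) ^ 2) has_real_derivative
      - 6 * max 0 (?\<psi> x) ^ 2 + 2 * max 0 (?\<psi> x) * (- 2 * (x - 1)) * (- 6 * (x - 1))) (at x)"
    by (rule DERIV_mult[rotated])
  also have "- 6 * max 0 (?\<psi> x) ^ 2 + 2 * max 0 (?\<psi> x) * (- 2 * (x - 1)) * (- 6 * (x - 1)) =
      - 6 * max 0 (?\<psi> x) ^ 2 + 24 * (x - 1)\<^sup>2 * max 0 (?\<psi> x)"
  proof -
    have "2 * y * (- 2 * (x - 1)) * (- 6 * (x - 1)) = 24 * (x - 1)\<^sup>2 * y" for y
      by (simp add: power2_eq_square algebra_simps)
    then show ?thesis by (simp only:)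
  qed
  finally show ?thesis .
qed

lemma deriv_bump: "deriv (bump q) = (\<lambda>x. - 6 * (x - 1) * max 0 (q + 1 - (x - 1)\<^sup>2) ^ 2)"
  using bump_deriv by (intro ext DERIV_imp_deriv)

lemma deriv2_bump: "deriv (deriv (bump q)) =
    (\<lambda>x. - 6 * max 0 (q + 1 - (x - 1)\<^sup>2) ^ 2 + 24 * (x - 1)\<^sup>2 * max 0 (q + 1 - (x - 1)\<^sup>2))"
  unfolding deriv_bump using bump_deriv2 by (intro ext DERIV_imp_deriv)

lemma C2_bump: "C2 (bump q)"
  unfolding C2_def
proof (intro conjI allI)
  show "bump q field_differentiable at x" for x
    using bump_deriv field_differentiable_def by blast
  show "deriv (bump q) field_differentiable at x" for x
    unfolding deriv_bump using bump_deriv2 field_differentiable_def by blast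
  show "continuous_on UNIV (deriv (deriv (bump q)))"
    unfolding deriv2_bump by (intro continuous_intros)
qed

lemma bump_nonneg: "0 \<le> bump q x"
  by (simp add: bump_def)

lemma bump_le: "0 \<le> q \<Longrightarrow> bump q x \<le> (q + 1) ^ 3"
  unfolding bump_def by (intro power_mono) auto

lemma bump_mono: "x \<le> y \<Longrightarrow> y \<le> 1 \<Longrightarrow> bump q x \<le> bump q y"
proof -
  assume "x \<le> y" "y \<le> 1"
  then have "(1 - y)\<^sup>2 \<le> (1 - x)\<^sup>2"
    by (intro power_mono) auto
  then show ?thesis
    unfolding bump_def power2_commute[of x 1] power2_commute[of y 1] by (intro power_mono) auto
qed

text \<open>On the unit interval the parabola is at least \<open>q + x\<close>; expanding the cube
  and dropping higher terms leaves linear growth. This growth is what is transferred to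
  \<open>s\<close>.\<close>

lemma bump_ge:
  assumes "0 \<le> q" "0 \<le> x" "x \<le> 1"
  shows "bump q 0 + 3 * q\<^sup>2 * x \<le> bump q x"
proof -
  have "x * x \<le> x * 1"
    using assms by (intro mult_left_mono) auto
  then have "q + x \<le> q + 1 - (x - 1)\<^sup>2"
    by (simp add: power2_eq_square algebra_simps)
  then have "(q + x) ^ 3 \<le> bump q x"
    unfolding bump_def using assms by (intro power_mono) auto
  moreover have "(q + x) ^ 3 = q ^ 3 + 3 * q\<^sup>2 * x + (3 * q * x\<^sup>2 + x ^ 3)"
    by (simp add: power2_eq_square power3_eq_cube algebra_simps)
  moreover have "0 \<le> 3 * q * x\<^sup>2 + x ^ 3"
    using assms by simp
  moreover have "bump q 0 = q ^ 3"
    using assms by (simp add: bump_def)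
  ultimately show ?thesis by linarith
qed

lemma bump_support:
  assumes "q \<le> 3"
  shows "compact (closure (support_on UNIV (bump q)))"
proof -
  have "\<bar>x\<bar> \<le> 3" if "bump q x \<noteq> 0" for x
  proof -
    have "\<bar>x - 1\<bar>\<^sup>2 \<le> 2\<^sup>2"
      using that assms by (cases "q + 1 - (x - 1)\<^sup>2 \<le> 0") (auto simp: bump_def)
    then have "\<bar>x - 1\<bar> \<le> 2"
      by (rule power2_le_imp_le) simp
    then show ?thesis by linarith
  qed
  then have "bounded (support_on UNIV (bump q))"
    unfolding bounded_iff support_on_def by (intro exI[of _ 3]) auto
  then show ?thesis
    by simp
qed

section \<open>Linear lower and upper bounds for the scale function\<close>

text \<open>Near 0 on the right, \<open>bump q\<close> has positive drift, so its value at
  \<open>x\<close> is at most its value near 0 plus \<open>H\<close> times the probability of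
  reaching \<open>b\<close> before 0. That probability is \<open>s x / s b\<close>, hence the linear
  growth of \<open>bump q\<close> bounds \<open>s\<close> from below.\<close>

lemma scale_lower_bound:
  assumes "real_diffusion M P Z" and scale: "scale_function P Z s" "s 0 = 0"
    and gen: "has_generator_form P Z a c"
    and cont: "continuous_on UNIV (\<lambda>x. (a x)\<^sup>2)" "continuous_on UNIV c" "a 0 \<noteq> 0"
  shows "\<exists>k>0. \<exists>b>0. \<forall>x. 0 < x \<and> x < b \<longrightarrow> k * x \<le> s x"
proof -
  interpret real_diffusion M P Z by fact
  define A where "A = (a 0)\<^sup>2"
  have A: "0 < A" using cont(3) by (simp add: A_def)
  \<comment> \<open>At 0 the generator maps \<open>bump q\<close> to \<open>6 * q * (A * (4 - q) / 2 + q * c 0)\<close>.\<close>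
  define q where "q = min 1 (A / (1 + \<bar>c 0\<bar>))"
  have q: "0 < q" "q \<le> 1"
    using A by (auto simp: q_def)
  have qc: "q * \<bar>c 0\<bar> \<le> A"
  proof -
    have "q * (1 + \<bar>c 0\<bar>) \<le> A / (1 + \<bar>c 0\<bar>) * (1 + \<bar>c 0\<bar>)"
      by (intro mult_right_mono) (auto simp: q_def)
    then have "q * (1 + \<bar>c 0\<bar>) \<le> A" by simp
    then show ?thesis using q by (simp add: distrib_left)
  qed
  define g where "g x = 1/2 * (a x)\<^sup>2 * deriv (deriv (bump q)) x + c x * deriv (bump q) x" for x
  have g0: "0 < g 0"
  proof -
    have g0: "g 0 = 6 * q * (A * (4 - q) / 2 + q * c 0)"
    proof -
      have "deriv (deriv (bump q)) 0 = 24 * q - 6 * q * q" "deriv (bump q) 0 = 6 * q * q"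
        using q unfolding deriv2_bump unfolding deriv_bump by (simp_all add: power2_eq_square)
      note d = this
      show ?thesis
        unfolding g_def A_def d by (simp add: field_simps)
    qed
    have "q * (- c 0) \<le> q * \<bar>c 0\<bar>"
      using q by (intro mult_left_mono) auto
    moreover have "A * 3 \<le> A * (4 - q)"
      using A q by (intro mult_left_mono) auto
    \<comment> \<open>The first term is at least \<open>3 * A / 2\<close> since
      \<open>q \<le> 1\<close>, and the second is at least \<open>- A\<close> by the choice of
      \<open>q\<close>.\<close>
    ultimately have "0 < A * (4 - q) / 2 + q * c 0"
      using qc A by linarith
    then show ?thesis
      unfolding g0 using q by simp
  qed
  have "continuous_on UNIV (deriv (deriv (bump q)))"
    using C2_bump by (simp add: C2_def)
  moreover have "continuous_on UNIV (deriv (bump q))"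
    unfolding deriv_bump by (intro continuous_intros)
  ultimately have "continuous_on UNIV g"
    unfolding g_def by (intro continuous_on_add continuous_on_mult continuous_on_const cont)
  then have "isCont g 0"
    by (simp add: continuous_on_eq_continuous_at)
  then have "(g \<longlongrightarrow> g 0) (at 0)"
    by (simp add: isCont_def)
  then have "\<forall>\<^sub>F y in at 0. g 0 / 2 < g y"
    using g0 by (intro order_tendstoD) auto
  then obtain r where r: "0 < r" "\<And>y. y \<noteq> 0 \<Longrightarrow> dist y 0 < r \<Longrightarrow> g 0 / 2 < g y"
    unfolding eventually_at by auto
  \<comment> \<open>Below \<open>r\<close> the function \<open>g\<close> exceeds half its value at
    0; below 1 the bump is increasing.\<close>
  define b where "b = min r 1"
  have b: "0 < b" "b \<le> 1" "b \<le> r" using r by (auto simp: b_def)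
  have "in_generator P Z (bump q) g"
    using gen C2_bump bump_support[of q] q unfolding has_generator_form_def g_def by auto
  then have "\<forall>\<^sub>F t in at_right 0. \<forall>x\<in>UNIV. dist ((semigroup_op P Z t (bump q) x - bump q x) / t) (g x) < g 0 / 4"
    unfolding in_generator_def using g0 by (intro uniform_limitD) auto
  then obtain t0 where t0: "0 < t0" "\<And>t x. 0 < t \<Longrightarrow> t < t0 \<Longrightarrow>
      dist ((semigroup_op P Z t (bump q) x - bump q x) / t) (g x) < g 0 / 4"
    unfolding eventually_at_right_field by auto
  \<comment> \<open>Uniform convergence of the difference quotients up to \<open>g 0 / 4\<close>
    leaves \<open>g 0 / 4\<close> of the lower bound \<open>g 0 / 2\<close>, with one
    \<open>t0\<close> valid for all \<open>y\<close>.\<close>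
  have drift: "bump q y + g 0 / 4 * t \<le> semigroup_op P Z t (bump q) y"
    if t: "0 < t" "t < t0" and y: "0 < y" "y < b" for t y
  proof -
    have "g 0 / 2 < g y"
      using r(2)[of y] y b by (simp add: dist_real_def)
    then have "g 0 / 4 \<le> (semigroup_op P Z t (bump q) y - bump q y) / t"
      using t0(2)[OF t, of y] unfolding dist_real_def by linarith
    then show ?thesis
      using t by (simp add: pos_le_divide_eq)
  qed
  have sm: "strict_mono s"
    using scale by (simp add: scale_function_def)
  have sb: "0 < s b"
    using strict_monoD[OF sm b(1)] scale(2) by simp
  have meas: "bump q \<in> borel_measurable borel"
    unfolding bump_def[abs_def] by measurable
  define H where "H = (q + 1) ^ 3"
  have H: "0 < H" using q by (simp add: H_def)
  have est: "bump q x \<le> bump q \<epsilon> + H * (s x / s b)" if e: "0 < \<epsilon>" "\<epsilon> < x" "x < b" for x \<epsilon>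
  proof -
    have sx: "0 < s x"
      using strict_monoD[OF sm, of 0 x] e scale(2) by simp
    have m: "measure (P x) {w \<in> space (P x). hitting_time Z b w < hitting_time Z 0 w} = s x / s b"
      using scale e unfolding scale_function_def by (auto dest: spec[of _ 0])
    \<comment> \<open>\<open>measure\<close> is 0 on non-measurable sets, so the strictly positive
      value \<open>s x / s b\<close> already proves that the event is measurable.\<close>
    have E: "{w \<in> space (P x). hitting_time Z b w < hitting_time Z 0 w} \<in> sets (P x)"
      using m sx sb measure_notin_sets by fastforce
    show ?thesis
      unfolding m[symmetric]
    proof (rule hitting_probability_bound[OF meas bump_nonneg _ _ e _ t0(1) _ E])
      show "bump q y \<le> H" for y
        unfolding H_def using q by (intro bump_le) simp
      show "bump q y \<le> bump q \<epsilon>" if "y \<le> \<epsilon>" for y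
        using that e b by (intro bump_mono) auto
      show "0 < g 0 / 4" using g0 by simp
      show "bump q y + g 0 / 4 * t \<le> semigroup_op P Z t (bump q) y"
        if "0 < t" "t < t0" "y \<in> {\<epsilon><..<b}" for t y
        using that e by (intro drift) auto
    qed
  qed
  have "3 * q\<^sup>2 * s b / H * x \<le> s x" if x: "0 < x" "x < b" for x
  proof -
    \<comment> \<open>The exit level \<epsilon> had to be above 0 to leave room for the grid; now it
      tends to 0 with \<open>x\<close> fixed.\<close>
    have "isCont (bump q) 0"
      using bump_deriv by (rule DERIV_isCont)
    then have "((\<lambda>\<epsilon>. bump q \<epsilon> + H * (s x / s b)) \<longlongrightarrow> bump q 0 + H * (s x / s b)) (at_right 0)"
      by (intro tendsto_intros) (simp add: isCont_def filterlim_at_split)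
    moreover have "\<forall>\<^sub>F \<epsilon> in at_right 0. bump q x \<le> bump q \<epsilon> + H * (s x / s b)"
      using x est by (intro eventually_at_rightI[of 0 x]) auto
    ultimately have "bump q x \<le> bump q 0 + H * (s x / s b)"
      by (rule tendsto_lowerbound) simp
    moreover have "bump q 0 + 3 * q\<^sup>2 * x \<le> bump q x"
      using q x b by (intro bump_ge) auto
    ultimately have "3 * q\<^sup>2 * x \<le> H * (s x / s b)"
      by linarith
    then show ?thesis
      using sb H by (simp add: field_simps)
  qed
  moreover have "0 < 3 * q\<^sup>2 * s b / H"
    using q sb H by simp
  ultimately show ?thesis
    using b(1) by blast
qed

text \<open>The mean value theorem with the maximum of the derivative on the unit interval. It
  allows the intrinsic scale \<open>sqrt (s t * (s t - s r))\<close> to be replaced by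
  \<open>L * sqrt (t * (t - r))\<close>, so that chaining can use ordinary dyadic points; the
  maximum with 1 only ensures that \<open>L\<close> is positive.\<close>

lemma C2_lipschitz:
  assumes "C2 s"
  shows "\<exists>L>0. \<forall>r t. 0 \<le> r \<longrightarrow> r \<le> t \<longrightarrow> t \<le> 1 \<longrightarrow> s t - s r \<le> L * (t - r)"
proof -
  have d: "(s has_real_derivative deriv s x) (at x)" for x
    using assms by (simp add: C2_def DERIV_deriv_iff_field_differentiable)
  have "continuous_on {0..1} (deriv s)"
    using assms unfolding C2_def
    by (intro continuous_at_imp_continuous_on ballI field_differentiable_imp_continuous_at) auto
  then have "\<exists>y\<in>{0..1}. \<forall>x\<in>{0..1}. deriv s x \<le> deriv s y"
    by (intro continuous_attains_sup) auto
  then obtain y where y: "\<And>x. x \<in> {0..1} \<Longrightarrow> deriv s x \<le> deriv s y"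
    by blast
  define L where "L = max 1 (deriv s y)"
  have "s t - s r \<le> L * (t - r)" if "0 \<le> r" "r \<le> t" "t \<le> 1" for r t
  proof (cases "r = t")
    case False
    then have "r < t" using that by simp
    from MVT2[OF this d] obtain z where z: "r < z" "z < t" "s t - s r = (t - r) * deriv s z"
      by blast
    have "deriv s z \<le> L"
      using y[of z] z that by (auto simp: L_def)
    then have "(t - r) * deriv s z \<le> (t - r) * L"
      using that by (intro mult_left_mono) auto
    then show ?thesis
      using z by (simp add: mult.commute)
  qed simp
  then show ?thesis
    by (intro exI[of _ L]) (auto simp: L_def)
qed

section \<open>Tails of permanental vectors\<close>

text \<open>The constant coefficient is the limit of the sum at \<open>0+\<close>, hence 0; divide
  by \<open>z\<close> and repeat. Only positive \<open>z\<close> are available, since the Laplace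
  transform is known on one side of the expansion point.\<close>

lemma powser_eq_0_right:
  fixes d :: "nat \<Rightarrow> real"
  assumes "0 < r" and "\<And>z. 0 < z \<Longrightarrow> z < r \<Longrightarrow> (\<lambda>n. d n * z ^ n) sums 0"
  shows "d n = 0"
proof -
  have zero: "d 0 = 0"
    if *: "\<And>z. 0 < z \<Longrightarrow> z < r \<Longrightarrow> (\<lambda>n. d n * z ^ n) sums 0" for d :: "nat \<Rightarrow> real"
  proof -
    let ?f = "\<lambda>z. \<Sum>n. d n * z ^ n"
    have "summable (\<lambda>n. d n * (r / 2) ^ n)"
      using *[of "r/2"] \<open>0 < r\<close> by (auto simp: sums_iff)
    then have "isCont ?f 0"
      by (rule isCont_powser) (use \<open>0 < r\<close> in auto)
    then have "(?f \<longlongrightarrow> d 0) (at_right 0)"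
      by (simp add: isCont_def powser_zero filterlim_at_split)
    moreover have "\<forall>\<^sub>F z in at_right 0. ?f z = 0"
      using eventually_at_right_less[of 0] eventually_at_right_real[OF \<open>0 < r\<close>]
      by eventually_elim (use * in \<open>auto simp: sums_iff\<close>)
    ultimately have "((\<lambda>_. 0) \<longlongrightarrow> d 0) (at_right (0::real))"
      by (rule Lim_transform_eventually)
    then show ?thesis
      by (simp add: tendsto_const_iff)
  qed
  from assms(2) show ?thesis
  proof (induction n arbitrary: d)
    case 0
    then show ?case by (intro zero)
  next
    case (Suc n)
    have "d 0 = 0"
      using Suc.prems by (intro zero)
    have "(\<lambda>n. d (Suc n) * z ^ n) sums 0" if z: "0 < z" "z < r" for z
    proof -
      have "(\<lambda>n. d (Suc n) * z ^ Suc n) sums 0"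
        using Suc.prems[OF z] \<open>d 0 = 0\<close> by (subst sums_Suc_iff) simp
      from sums_divide[OF this, of z] show ?thesis
        using z by (simp add: field_simps)
    qed
    then show ?case
      using Suc.IH[of "\<lambda>n. d (Suc n)"] by simp
  qed
qed

text \<open>
  Expanding around \<open>a = 1\<close> turns both sides into power series in \<open>z = 1 - a\<close>; the coefficients on the
  left are nonnegative, so the identity persists beyond \<open>z = 1\<close> up to the radius of convergence of the
  binomial series.
\<close>

lemma exp_moment_extension:
  fixes X W :: "'a \<Rightarrow> real"
  assumes [measurable]: "X \<in> borel_measurable N" "W \<in> borel_measurable N"
    and nn: "\<And>w. w \<in> space N \<Longrightarrow> 0 \<le> X w" "\<And>w. w \<in> space N \<Longrightarrow> 0 \<le> W w"
    and p: "0 < p" and q: "0 \<le> q"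
    and LT: "\<And>a. 0 < a \<Longrightarrow> (\<integral>\<^sup>+w. ennreal (W w * exp (- a * X w)) \<partial>N) = ennreal ((p + a * q) powr - \<alpha>)"
    and l: "0 \<le> l" "l * q < p"
  shows "(\<integral>\<^sup>+w. ennreal (W w * exp (l * X w)) \<partial>N) = ennreal ((p - l * q) powr - \<alpha>)"
proof -
  define c where "c n = (\<integral>\<^sup>+w. ennreal (W w * exp (- X w) * X w ^ n / fact n) \<partial>N)" for n
  have expand: "(\<integral>\<^sup>+w. ennreal (W w * exp ((z - 1) * X w)) \<partial>N) = (\<Sum>n. c n * ennreal (z ^ n))"
    if "0 \<le> z" for z
  proof -
    have "ennreal (W w * exp ((z - 1) * X w)) =
        (\<Sum>n. ennreal (W w * exp (- X w) * X w ^ n / fact n) * ennreal (z ^ n))"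
      if w: "w \<in> space N" for w
    proof -
      have "(\<lambda>n. W w * exp (- X w) * ((z * X w) ^ n /\<^sub>R fact n)) sums (W w * exp (- X w) * exp (z * X w))"
        by (intro sums_mult exp_converges)
      also have "(\<lambda>n. W w * exp (- X w) * ((z * X w) ^ n /\<^sub>R fact n)) =
          (\<lambda>n. W w * exp (- X w) * X w ^ n / fact n * z ^ n)"
        by (auto simp: field_simps power_mult_distrib)
      also have "W w * exp (- X w) * exp (z * X w) = W w * exp ((z - 1) * X w)"
        by (simp add: mult.assoc exp_add [symmetric] algebra_simps)
      finally have "(\<Sum>n. ennreal (W w * exp (- X w) * X w ^ n / fact n * z ^ n)) =
          ennreal (W w * exp ((z - 1) * X w))"
        using nn w \<open>0 \<le> z\<close> by (intro suminf_ennreal_eq) auto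
      then show ?thesis
        using nn w \<open>0 \<le> z\<close> by (simp add: ennreal_mult[symmetric])
    qed
    then have "(\<integral>\<^sup>+w. ennreal (W w * exp ((z - 1) * X w)) \<partial>N) =
        (\<integral>\<^sup>+w. (\<Sum>n. ennreal (W w * exp (- X w) * X w ^ n / fact n) * ennreal (z ^ n)) \<partial>N)"
      by (intro nn_integral_cong) simp
    also have "\<dots> = (\<Sum>n. \<integral>\<^sup>+w. ennreal (W w * exp (- X w) * X w ^ n / fact n) * ennreal (z ^ n) \<partial>N)"
      by (intro nn_integral_suminf) measurable
    also have "\<dots> = (\<Sum>n. c n * ennreal (z ^ n))"
      unfolding c_def by (intro suminf_cong nn_integral_multc) measurable
    finally show ?thesis .
  qed
  \<comment> \<open>With this \<open>y\<close>,
    \<open>(p + q) * (1 + z * y) = p + (1 - z) * q\<close>, and the binomial series converges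
    exactly as long as \<open>z * q < p + q\<close> for nonnegative \<open>z\<close> when
    \<open>q\<close> is positive.\<close>
  define y where "y = - q / (p + q)"
  define b where "b n = (p + q) powr - \<alpha> * ((- \<alpha> gchoose n) * y ^ n)" for n
  have binom: "(\<lambda>n. b n * z ^ n) sums (p + (1 - z) * q) powr - \<alpha>" if z: "0 \<le> z" "z * q < p + q" for z
  proof -
    have *: "\<bar>z * y\<bar> < 1"
      using z p q by (simp add: y_def abs_mult field_simps)
    have "(\<lambda>n. (p + q) powr - \<alpha> * ((- \<alpha> gchoose n) * (z * y) ^ n)) sums
        ((p + q) powr - \<alpha> * (1 + z * y) powr - \<alpha>)"
      by (intro sums_mult gen_binomial_real *)
    also have "(p + q) powr - \<alpha> * (1 + z * y) powr - \<alpha> = ((p + q) * (1 + z * y)) powr - \<alpha>"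
      using * p q by (intro powr_mult[symmetric])
    also have "(p + q) * (1 + z * y) = p + (1 - z) * q"
      using p q by (simp add: y_def field_simps)
    finally show ?thesis
      by (simp add: b_def power_mult_distrib mult_ac)
  qed
  \<comment> \<open>Any \<open>z\<close> strictly between 0 and 1 would do: the whole series is a
    finite Laplace transform there.\<close>
  have fin: "c n < \<infinity>" for n
  proof -
    have "c n * ennreal ((1/2) ^ n) \<le> (\<Sum>n. c n * ennreal ((1/2) ^ n))"
      using sum_le_suminf[of "\<lambda>n. c n * ennreal ((1/2) ^ n)" "{n}"] by (simp add: summableI)
    also have "\<dots> < \<infinity>"
      using expand[of "1/2"] LT[of "1/2"] by simp
    finally show ?thesis
      by (auto simp: ennreal_mult_less_top less_top[symmetric])
  qed
  define e where "e n = enn2real (c n)" for n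
  have ce: "c n = ennreal (e n)" "0 \<le> e n" for n
    using fin[of n] by (auto simp: e_def)
  have "e n = b n" for n
  proof -
    have "(\<lambda>n. (e n - b n) * z ^ n) sums 0" if z: "0 < z" "z < 1" for z
    proof -
      have "(\<Sum>n. ennreal (e n * z ^ n)) = ennreal ((p + (1 - z) * q) powr - \<alpha>)"
        using expand[of z] LT[of "1 - z"] z by (simp add: ce ennreal_mult)
      then have "(\<lambda>n. ennreal (e n * z ^ n)) sums ennreal ((p + (1 - z) * q) powr - \<alpha>)"
        by (metis summableI summable_sums)
      then have "(\<lambda>n. e n * z ^ n) sums ((p + (1 - z) * q) powr - \<alpha>)"
        using z ce by (subst (asm) sums_ennreal) auto
      moreover have "(\<lambda>n. b n * z ^ n) sums ((p + (1 - z) * q) powr - \<alpha>)"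
        using z p q mult_right_mono[of z 1 q] by (intro binom) linarith+
      ultimately have "(\<lambda>n. e n * z ^ n - b n * z ^ n) sums 0"
        using sums_diff by fastforce
      then show ?thesis by (simp add: algebra_simps)
    qed
    then show ?thesis
      using powser_eq_0_right[of 1 "\<lambda>n. e n - b n"] by simp
  qed
  \<comment> \<open>\<open>z = 1 + l\<close> corresponds to the argument \<open>a = - l\<close>, and
    \<open>l * q < p\<close> is the convergence condition at this point.\<close>
  then have "(\<lambda>n. e n * (1 + l) ^ n) sums (p - l * q) powr - \<alpha>"
    using binom[of "1 + l"] l by (simp add: algebra_simps)
  then have "(\<Sum>n. ennreal (e n * (1 + l) ^ n)) = ennreal ((p - l * q) powr - \<alpha>)"
    using ce l by (intro suminf_ennreal_eq) auto
  then show ?thesis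
    using expand[of "1 + l"] l by (simp add: ce ennreal_mult)
qed

section \<open>Laplace transforms and exponential moments of one and two coordinates\<close>

lemma det_two_by_two:
  assumes "A \<in> carrier_mat 2 2"
  shows "Determinant.det A = A $$ (0,0) * A $$ (1,1) - A $$ (0,1) * A $$ (1,0)"
proof -
  have c: "mat_delete A i 0 \<in> carrier_mat 1 1" for i
    using assms by (auto simp: mat_delete_def)
  have "Determinant.det A = (\<Sum>i<2. A $$ (i, 0) * cofactor A i 0)"
    by (rule laplace_expansion_column[OF assms]) simp
  also have "\<dots> = A $$ (0,0) * A $$ (1,1) - A $$ (0,1) * A $$ (1,0)"
    using assms by (simp add: numeral_2_eq_2 cofactor_def det_single[OF c])
      (simp add: mat_delete_def)
  finally show ?thesis .
qed

lemma kernel_carrier: "1\<^sub>m n + kernel_mat n K t * mat_diag n \<sigma> \<in> carrier_mat n n"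
  by (intro add_carrier_mat mult_carrier_mat[of _ n n]) (auto simp: kernel_mat_def mat_diag_def)

lemma kernel_entry:
  assumes "i < n" "j < n"
  shows "(1\<^sub>m n + kernel_mat n K t * mat_diag n \<sigma>) $$ (i, j) =
    (if i = j then 1 else 0) + K (t i) (t j) * \<sigma> j"
  using assms by (simp add: kernel_mat_def mat_diag_mult_right[of _ n n])

context
  fixes \<alpha> :: real and S :: "real set" and K :: "real \<Rightarrow> real \<Rightarrow> real"
    and N :: "'b measure" and X :: "real \<Rightarrow> 'b \<Rightarrow> real"
  assumes perm: "permanental_process \<alpha> S K N X"
begin

lemma permanental_prob_space: "prob_space N"
  using perm by (simp add: permanental_process_def)

lemma permanental_measurable: "t \<in> S \<Longrightarrow> X t \<in> borel_measurable N"
  using perm by (simp add: permanental_process_def)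

lemma permanental_nonneg: "t \<in> S \<Longrightarrow> w \<in> space N \<Longrightarrow> 0 \<le> X t w"
  using perm by (simp add: permanental_process_def)

lemma permanental_laplace:
  assumes "\<And>i. i < n \<Longrightarrow> t i \<in> S" "\<And>i. i < n \<Longrightarrow> 0 < \<sigma> i"
  shows "(\<integral>\<^sup>+w. ennreal (exp (- (\<Sum>i<n. \<sigma> i * X (t i) w))) \<partial>N) =
    ennreal (Determinant.det (1\<^sub>m n + kernel_mat n K t * mat_diag n \<sigma>) powr - \<alpha>)"
proof -
  interpret N: prob_space N by (rule permanental_prob_space)
  have meas: "(\<lambda>w. exp (- (\<Sum>i<n. \<sigma> i * X (t i) w))) \<in> borel_measurable N"
    using assms permanental_measurable by (intro measurable_compose[OF _ borel_measurable_exp]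
      borel_measurable_uminus borel_measurable_sum borel_measurable_times) auto
  have "integrable N (\<lambda>w. exp (- (\<Sum>i<n. \<sigma> i * X (t i) w)))"
    using assms permanental_nonneg
    by (intro N.integrable_const_bound[where B=1] meas)
       (auto intro!: AE_I2 sum_nonneg mult_nonneg_nonneg simp: less_imp_le)
  then have "(\<integral>\<^sup>+w. ennreal (exp (- (\<Sum>i<n. \<sigma> i * X (t i) w))) \<partial>N) =
      ennreal (\<integral>w. exp (- (\<Sum>i<n. \<sigma> i * X (t i) w)) \<partial>N)"
    by (intro nn_integral_eq_integral) auto
  then show ?thesis
    using perm assms by (simp add: permanental_process_def powr_minus_divide)
qed

lemma permanental_laplace1:
  assumes "t \<in> S" "0 < a"
  shows "(\<integral>\<^sup>+w. ennreal (exp (- a * X t w)) \<partial>N) = ennreal ((1 + a * K t t) powr - \<alpha>)"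
proof -
  have "Determinant.det (1\<^sub>m 1 + kernel_mat 1 K (\<lambda>_. t) * mat_diag 1 (\<lambda>_. a)) = 1 + a * K t t"
    by (subst det_single[OF kernel_carrier], subst kernel_entry) auto
  with permanental_laplace[of 1 "\<lambda>_. t" "\<lambda>_. a"] assms show ?thesis
    by (simp only: lessThan_Suc One_nat_def) simp
qed

lemma permanental_laplace2:
  assumes "t \<in> S" "r \<in> S" "0 < a" "0 < b"
  shows "(\<integral>\<^sup>+w. ennreal (exp (- b * X r w) * exp (- a * X t w)) \<partial>N) =
    ennreal ((1 + a * K t t + b * K r r + a * b * (K t t * K r r - K t r * K r t)) powr - \<alpha>)"
proof -
  let ?t = "\<lambda>i::nat. if i = 0 then t else r" and ?\<sigma> = "\<lambda>i::nat. if i = 0 then a else b"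
  have "(\<integral>\<^sup>+w. ennreal (exp (- (\<Sum>i<2. ?\<sigma> i * X (?t i) w))) \<partial>N) =
    ennreal (Determinant.det (1\<^sub>m 2 + kernel_mat 2 K ?t * mat_diag 2 ?\<sigma>) powr - \<alpha>)"
    using assms by (intro permanental_laplace) auto
  also have "(\<lambda>w. \<Sum>i<2. ?\<sigma> i * X (?t i) w) = (\<lambda>w. a * X t w + b * X r w)"
    by (simp add: numeral_2_eq_2)
  also have "Determinant.det (1\<^sub>m 2 + kernel_mat 2 K ?t * mat_diag 2 ?\<sigma>) =
      1 + a * K t t + b * K r r + a * b * (K t t * K r r - K t r * K r t)"
    by (subst det_two_by_two[OF kernel_carrier]) (simp add: kernel_entry algebra_simps)
  finally show ?thesis
    by (simp add: exp_add[symmetric] algebra_simps)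
qed

lemma permanental_exp_moment:
  assumes "t \<in> S" "0 \<le> K t t" "0 \<le> l" "l * K t t < 1"
  shows "(\<integral>\<^sup>+w. ennreal (exp (l * X t w)) \<partial>N) = ennreal ((1 - l * K t t) powr - \<alpha>)"
  using exp_moment_extension[of "X t" N "\<lambda>_. 1" 1 "K t t" \<alpha> l] assms
    permanental_measurable permanental_nonneg permanental_laplace1 by simp

text \<open>With the argument at \<open>r\<close> fixed at \<open>l\<close>, the two-point
  determinant is affine in the argument \<open>a\<close> at \<open>t\<close>, with constant term
  \<open>1 + l * K r r\<close> and slope \<open>K t t + l * D\<close>. Taking
  \<open>exp (- l * X r w)\<close> as the weight \<open>W\<close>, only \<open>a\<close> has to be
  continued, to \<open>- l\<close>.\<close>

lemma permanental_exp_moment_diff: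
  assumes "t \<in> S" "r \<in> S" "0 \<le> K t t" "0 \<le> K r r" "0 < l"
    and D: "D = K t t * K r r - K t r * K r t" "0 \<le> D"
    and pos: "0 < 1 - l * (K t t - K r r) - l\<^sup>2 * D"
  shows "(\<integral>\<^sup>+w. ennreal (exp (l * (X t w - X r w))) \<partial>N) =
    ennreal ((1 - l * (K t t - K r r) - l\<^sup>2 * D) powr - \<alpha>)"
proof -
  have "(\<integral>\<^sup>+w. ennreal (exp (- l * X r w) * exp (l * X t w)) \<partial>N) =
      ennreal ((1 + l * K r r - l * (K t t + l * D)) powr - \<alpha>)"
  proof (rule exp_moment_extension)
    show "X t \<in> borel_measurable N" "(\<lambda>w. exp (- l * X r w)) \<in> borel_measurable N"
      using permanental_measurable assms by auto
    show "(\<integral>\<^sup>+w. ennreal (exp (- l * X r w) * exp (- a * X t w)) \<partial>N) =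
        ennreal ((1 + l * K r r + a * (K t t + l * D)) powr - \<alpha>)" if "0 < a" for a
    proof -
      have "1 + a * K t t + l * K r r + a * l * D = 1 + l * K r r + a * (K t t + l * D)"
        by (simp add: algebra_simps)
      with permanental_laplace2[OF assms(1,2) that \<open>0 < l\<close>] show ?thesis
        by (simp only: D(1))
    qed
    show "l * (K t t + l * D) < 1 + l * K r r"
      using pos by (simp add: algebra_simps power2_eq_square)
  qed (use assms permanental_nonneg in \<open>auto intro!: add_pos_nonneg\<close>)
  then show ?thesis
    by (simp add: exp_add[symmetric] algebra_simps power2_eq_square)
qed

end

lemma (in prob_space) chernoff_bound:
  assumes [measurable]: "Z \<in> borel_measurable M" and "0 < l" "0 \<le> C"
    and le: "(\<integral>\<^sup>+w. ennreal (exp (l * Z w)) \<partial>M) \<le> ennreal C"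
  shows "prob {w \<in> space M. y \<le> Z w} \<le> C * exp (- l * y)"
proof -
  have "emeasure M {w \<in> space M. y \<le> Z w} = (\<integral>\<^sup>+w. indicator {w \<in> space M. y \<le> Z w} w \<partial>M)"
    by simp
  also have "\<dots> \<le> (\<integral>\<^sup>+w. ennreal (exp (l * Z w)) * ennreal (exp (- l * y)) \<partial>M)"
    using \<open>0 < l\<close> by (intro nn_integral_mono)
      (auto split: split_indicator simp: ennreal_mult[symmetric] exp_add[symmetric] ennreal_ge_1)
  also have "\<dots> \<le> ennreal C * ennreal (exp (- l * y))"
    using le by (simp add: nn_integral_multc mult_right_mono)
  finally show ?thesis
    using \<open>0 \<le> C\<close> by (simp add: emeasure_eq_measure ennreal_mult[symmetric] mult_nonneg_nonneg)
qed

section \<open>Kernel bounds and the resulting tail estimates\<close>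

text \<open>For every \<open>x\<close>, the function \<open>min (s x) (s y)\<close> is nondecreasing
  in \<open>y\<close> and 1-Lipschitz with respect to \<open>s y\<close>; integrate over \<mu>. It
  is integrable because \<mu> is finite and lives on the positive half-line, where the minimum lies
  between 0 and \<open>s y\<close>.\<close>

lemma potential_fun_diff:
  assumes s: "strict_mono s" "continuous_on UNIV s" "s 0 = 0"
    and \<mu>: "finite_measure \<mu>" "sets \<mu> = sets (restrict_space borel {0<..})"
    and "0 \<le> r" "r \<le> t"
  shows "potential_fun (u_T0 s) \<mu> r \<le> potential_fun (u_T0 s) \<mu> t"
    and "potential_fun (u_T0 s) \<mu> t - potential_fun (u_T0 s) \<mu> r \<le> measure \<mu> (space \<mu>) * (s t - s r)"
proof -
  interpret finite_measure \<mu> by fact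
  have sp: "space \<mu> = {0<..}"
    using sets_eq_imp_space_eq[OF \<mu>(2)] by (simp add: space_restrict_space)
  have mono: "s x \<le> s y \<longleftrightarrow> x \<le> y" for x y
    using s(1) by (simp add: strict_mono_less_eq)
  have pos: "0 \<le> s x" if "0 \<le> x" for x
    using mono[of 0 x] that s(3) by simp
  have [measurable]: "s \<in> borel_measurable \<mu>"
    using measurable_restrict_space1[OF borel_measurable_continuous_onI[OF s(2)], of "{0<..}"]
    by (simp cong: measurable_cong_sets add: \<mu>(2))
  have int: "integrable \<mu> (\<lambda>x. min (s x) (s y))" if "0 \<le> y" for y
    using that by (intro integrable_const_bound[where B="s y"]) (auto simp: sp pos intro!: AE_I2)
  show "potential_fun (u_T0 s) \<mu> r \<le> potential_fun (u_T0 s) \<mu> t"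
    unfolding potential_fun_def u_T0_def using assms mono[of r t]
    by (intro integral_mono int) auto
  have "potential_fun (u_T0 s) \<mu> t - potential_fun (u_T0 s) \<mu> r =
      (\<integral>x. min (s x) (s t) - min (s x) (s r) \<partial>\<mu>)"
    unfolding potential_fun_def u_T0_def using assms by (intro Bochner_Integration.integral_diff[symmetric] int) auto
  also have "\<dots> \<le> (\<integral>x. s t - s r \<partial>\<mu>)"
    using assms mono[of r t] by (intro integral_mono Bochner_Integration.integrable_diff int integrable_const) auto
  finally show "potential_fun (u_T0 s) \<mu> t - potential_fun (u_T0 s) \<mu> r \<le> measure \<mu> (space \<mu>) * (s t - s r)"
    by simp
qed

text \<open>With value 0 at the origin, the Lipschitz bound becomes a bound by total mass times
  \<open>s t\<close>; this is where the summand \<bar>\<mu>\<bar> of the final constant comes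
  from.\<close>

lemma potential_fun_0:
  assumes "strict_mono s" "s 0 = 0" "sets \<mu> = sets (restrict_space borel {0<..})"
  shows "potential_fun (u_T0 s) \<mu> 0 = 0"
proof -
  have sp: "space \<mu> = {0<..}"
    using sets_eq_imp_space_eq[OF assms(3)] by (simp add: space_restrict_space)
  have "potential_fun (u_T0 s) \<mu> 0 = (\<integral>x. 0 \<partial>\<mu>)"
    unfolding potential_fun_def u_T0_def using assms strict_monoD[OF assms(1), of 0]
    by (intro Bochner_Integration.integral_cong) (auto simp: sp min_def less_le_not_le)
  then show ?thesis by simp
qed

context
  fixes \<alpha> m L :: real and N :: "'b measure" and X :: "real \<Rightarrow> 'b \<Rightarrow> real"
    and s :: "real \<Rightarrow> real" and \<mu> :: "real measure"
  assumes perm: "permanental_process \<alpha> {0..1} (v_kernel s \<mu>) N X"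
    and "0 < \<alpha>"
    and s: "strict_mono s" "continuous_on UNIV s" "s 0 = 0"
    and \<mu>: "finite_measure \<mu>" "sets \<mu> = sets (restrict_space borel {0<..})"
    and m_def: "m = measure \<mu> (space \<mu>)"
begin

interpretation N: prob_space N
  using perm by (rule permanental_prob_space)

lemma X_measurable [measurable]: "t \<in> {0..1} \<Longrightarrow> X t \<in> borel_measurable N"
  using perm by (rule permanental_measurable)

lemma scale_diff_nonneg: "r \<le> t \<Longrightarrow> s r \<le> s t"
  using s(1) by (simp add: strict_mono_less_eq)

lemma mass_nonneg: "0 \<le> m"
  by (simp add: m_def)

lemma v_kernel_bounds:
  assumes "0 \<le> r" "r \<le> t"
  shows "v_kernel s \<mu> t t \<le> (1 + m) * s t" "0 \<le> v_kernel s \<mu> t t"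
    "v_kernel s \<mu> r r \<le> v_kernel s \<mu> t t"
    "v_kernel s \<mu> t t - v_kernel s \<mu> r r \<le> (1 + m) * (s t - s r)"
    "v_kernel s \<mu> t t * v_kernel s \<mu> r r - v_kernel s \<mu> t r * v_kernel s \<mu> r t =
      v_kernel s \<mu> r r * (s t - s r)"
proof -
  define g where "g = potential_fun (u_T0 s) \<mu>"
  have g: "g r \<le> g t" "g t - g r \<le> m * (s t - s r)" "0 \<le> g t" "g t \<le> m * s t"
    using potential_fun_diff[OF s \<mu>, of r t] potential_fun_diff[OF s \<mu>, of 0 t]
      potential_fun_0[OF s(1,3) \<mu>(2)] assms s by (auto simp: g_def m_def)
  have st: "s r \<le> s t" "0 \<le> s t"
    using scale_diff_nonneg[of r t] scale_diff_nonneg[of 0 t] assms s by auto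
  \<comment> \<open>The kernel is not symmetric, but for \<open>r \<le> t\<close> the entries at
    \<open>(t, r)\<close> and \<open>(r, r)\<close> coincide, so the determinant factors with
    \<open>v r r\<close> in front.\<close>
  have v: "v_kernel s \<mu> t t = s t + g t" "v_kernel s \<mu> r r = s r + g r"
    "v_kernel s \<mu> t r = s r + g r" "v_kernel s \<mu> r t = s r + g t"
    using st by (auto simp: v_kernel_def u_T0_def g_def)
  show "v_kernel s \<mu> t t \<le> (1 + m) * s t" "0 \<le> v_kernel s \<mu> t t"
    "v_kernel s \<mu> r r \<le> v_kernel s \<mu> t t"
    "v_kernel s \<mu> t t - v_kernel s \<mu> r r \<le> (1 + m) * (s t - s r)"
    using g st by (simp_all add: v distrib_right)
  show "v_kernel s \<mu> t t * v_kernel s \<mu> r r - v_kernel s \<mu> t r * v_kernel s \<mu> r t =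
      v_kernel s \<mu> r r * (s t - s r)"
    by (simp add: v algebra_simps)
qed

text \<open>The exponential moment has its singularity at \<open>1 / v t t\<close>; the chosen
  \<open>l\<close> keeps the base at least \<kappa>. The exponential rate
  \<open>1 - \<kappa>\<close> can thus be made as close to 1 as desired, at the price of the factor
  in front only.\<close>

lemma tail_one_point:
  assumes t: "0 < t" "t \<le> 1" and \<kappa>: "0 < \<kappa>" "\<kappa> < 1"
  shows "measure N {w \<in> space N. x * ((1 + m) * s t) \<le> X t w} \<le> \<kappa> powr - \<alpha> * exp (- (1 - \<kappa>) * x)"
proof -
  have st: "0 < s t"
    using strict_monoD[OF s(1), of 0 t] t s by simp
  define A l where "A = v_kernel s \<mu> t t" and "l = (1 - \<kappa>) / ((1 + m) * s t)"
  have A: "0 \<le> A" "A \<le> (1 + m) * s t"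
    using v_kernel_bounds[of t t] t by (auto simp: A_def)
  have c: "0 < (1 + m) * s t"
    using st mass_nonneg by simp
  have l: "0 < l"
    using c \<kappa> unfolding l_def by (intro divide_pos_pos) auto
  have lA: "l * A \<le> 1 - \<kappa>"
    using mult_left_mono[OF A(2), of l] l c by (simp add: l_def split: if_splits)
  have "(\<integral>\<^sup>+w. ennreal (exp (l * X t w)) \<partial>N) = ennreal ((1 - l * A) powr - \<alpha>)"
    using permanental_exp_moment[OF perm, of t l] A l lA t \<kappa> by (simp add: A_def)
  also have "\<dots> \<le> ennreal (\<kappa> powr - \<alpha>)"
    using lA \<kappa> \<open>0 < \<alpha>\<close> by (intro ennreal_leI powr_mono2') auto
  finally have "measure N {w \<in> space N. x * ((1 + m) * s t) \<le> X t w} \<le>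
      \<kappa> powr - \<alpha> * exp (- l * (x * ((1 + m) * s t)))"
    using l t by (intro N.chernoff_bound) auto
  also have "- l * (x * ((1 + m) * s t)) = - (1 - \<kappa>) * x"
  proof -
    have "(1 - \<kappa>) / c * (x * c) = (1 - \<kappa>) * x" if "0 < c" for c :: real
      using that by simp
    from this[OF c] show ?thesis
      by (simp only: l_def mult_minus_left)
  qed
  finally show ?thesis .
qed

text \<open>The condition on \<open>l\<close> bounds both the first-order term
  \<open>l * (A - B)\<close> and the second-order term of the base, so the exponential moments of
  the increment and of its negative are uniformly bounded; the leading factor 2 counts these two
  tails.\<close>

lemma tail_increment:
  assumes rt: "0 \<le> r" "r \<le> t" "t \<le> 1" and l: "0 < l" "l * (1 + m) * sqrt (s t * (s t - s r)) \<le> 1 / 4"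
  shows "measure N {w \<in> space N. y \<le> \<bar>X t w - X r w\<bar>} \<le> 2 * 2 powr \<alpha> * exp (- l * y)"
proof -
  define A B \<Delta> where "A = v_kernel s \<mu> t t" and "B = v_kernel s \<mu> r r" and "\<Delta> = s t - s r"
  note d = A_def[symmetric] B_def[symmetric] \<Delta>_def[symmetric]
  have \<Delta>: "0 \<le> \<Delta>" "\<Delta> \<le> s t"
    using scale_diff_nonneg[of r t] scale_diff_nonneg[of 0 r] rt s by (auto simp: \<Delta>_def)
  note b = v_kernel_bounds[of r t, OF rt(1,2), unfolded d]
  have B: "0 \<le> B"
    using v_kernel_bounds[of r r] rt by (simp add: B_def)
  \<comment> \<open>Since \<Delta> is at most \<open>s t\<close>, the difference of the diagonal
    entries is also controlled by the common scale.\<close>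
  have sq: "\<Delta> \<le> sqrt (s t * \<Delta>)"
    using \<Delta> by (intro real_le_rsqrt) (auto simp: power2_eq_square intro!: mult_mono)
  have AB: "l * (A - B) \<le> 1 / 4"
  proof -
    have "l * (A - B) \<le> l * ((1 + m) * sqrt (s t * \<Delta>))"
      using l b(4) sq mass_nonneg by (intro mult_left_mono) (auto intro: order_trans[OF b(4)] mult_left_mono)
    then show ?thesis using l(2) by (simp only: d mult.assoc)
  qed
  have D: "l\<^sup>2 * (B * \<Delta>) \<le> 1 / 16"
  proof -
    have "B * \<Delta> \<le> (1 + m) * s t * \<Delta>"
      using b \<Delta> by (intro mult_right_mono) auto
    also have "\<dots> \<le> (1 + m)\<^sup>2 * (s t * \<Delta>)"
      using mass_nonneg \<Delta> mult_right_mono[of 1 "1 + m" "(1 + m) * (s t * \<Delta>)"]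
      by (simp add: power2_eq_square mult.assoc)
    finally have "l\<^sup>2 * (B * \<Delta>) \<le> l\<^sup>2 * ((1 + m)\<^sup>2 * (s t * \<Delta>))"
      by (intro mult_left_mono) auto
    also have "\<dots> = (l * (1 + m) * sqrt (s t * \<Delta>))\<^sup>2"
      using \<Delta> by (simp add: power_mult_distrib mult_ac)
    also have "\<dots> \<le> (1 / 4)\<^sup>2"
      using l mass_nonneg \<Delta> by (intro power_mono) (auto simp: d)
    finally show ?thesis by (simp add: power2_eq_square)
  qed
  have D0: "0 \<le> l\<^sup>2 * (B * \<Delta>)" "0 \<le> B * \<Delta>" "0 \<le> l * (A - B)"
    using B \<Delta> b l by auto
  \<comment> \<open>The base loses at most 1/4 through the first-order term and 1/16 through the
    second-order one, so it stays above 1/2.\<close>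
  have half: "x powr - \<alpha> \<le> 2 powr \<alpha>" if "1 / 2 \<le> x" for x
    using powr_mono2'[of "- \<alpha>" "1/2" x] that \<open>0 < \<alpha>\<close> by (simp add: powr_minus_divide powr_divide)
  have 1: "(\<integral>\<^sup>+w. ennreal (exp (l * (X t w - X r w))) \<partial>N) \<le> ennreal (2 powr \<alpha>)"
    using permanental_exp_moment_diff[OF perm, of t r l "B * \<Delta>"] rt l B b D0 AB D
    by (auto simp: d intro!: ennreal_leI half)
  have "(\<integral>\<^sup>+w. ennreal (exp (l * (X r w - X t w))) \<partial>N) =
      ennreal ((1 - l * (B - A) - l\<^sup>2 * (B * \<Delta>)) powr - \<alpha>)"
  proof -
    \<comment> \<open>Exchanging \<open>r\<close> and \<open>t\<close> leaves the determinant
      unchanged and reverses the sign of the first-order term, which now increases the base.\<close>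
    have "l * (B - A) = - (l * (A - B))"
      by (simp add: algebra_simps)
    then have "0 < 1 - l * (B - A) - l\<^sup>2 * (B * \<Delta>)"
      using D D0 by linarith
    then show ?thesis
      using permanental_exp_moment_diff[OF perm, of r t l "B * \<Delta>"] rt l B b D0
      by (simp add: d mult.commute[of B A] mult.commute[of "v_kernel s \<mu> r t"])
  qed
  also have "\<dots> \<le> ennreal (2 powr \<alpha>)"
    using D0 D by (intro ennreal_leI half) (auto simp: algebra_simps)
  finally have 2: "(\<integral>\<^sup>+w. ennreal (exp (l * (X r w - X t w))) \<partial>N) \<le> ennreal (2 powr \<alpha>)" .
  have [measurable]: "X t \<in> borel_measurable N" "X r \<in> borel_measurable N"
    using rt by auto
  have "{w \<in> space N. y \<le> \<bar>X t w - X r w\<bar>} =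
      {w \<in> space N. y \<le> X t w - X r w} \<union> {w \<in> space N. y \<le> X r w - X t w}"
    by auto
  then have "measure N {w \<in> space N. y \<le> \<bar>X t w - X r w\<bar>} \<le>
      measure N {w \<in> space N. y \<le> X t w - X r w} + measure N {w \<in> space N. y \<le> X r w - X t w}"
    by (simp add: measure_Un_le)
  also have "\<dots> \<le> 2 powr \<alpha> * exp (- l * y) + 2 powr \<alpha> * exp (- l * y)"
    using 1 2 l by (intro add_mono N.chernoff_bound) auto
  finally show ?thesis by (simp add: mult_ac)
qed

text \<open>The factor 4 makes \<open>l = 1 / k\<close> meet the threshold 1/4 of the increment
  bound. The maximum of the two times gives a symmetric statement and retains the decay of the scale
  near 0.\<close>

lemma tail_increment_lipschitz:
  assumes L: "0 < L" "\<And>r t. 0 \<le> r \<Longrightarrow> r \<le> t \<Longrightarrow> t \<le> 1 \<Longrightarrow> s t - s r \<le> L * (t - r)"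
    and rt: "r \<in> {0..1}" "t \<in> {0..1}" "r \<noteq> t"
  shows "measure N {w \<in> space N. x * (4 * (1 + m) * L * sqrt (max r t * \<bar>t - r\<bar>)) \<le> \<bar>X t w - X r w\<bar>}
    \<le> 2 * 2 powr \<alpha> * exp (- x)"
proof -
  have *: "measure N {w \<in> space N. x * (4 * (1 + m) * L * sqrt (t * (t - r))) \<le> \<bar>X t w - X r w\<bar>}
      \<le> 2 * 2 powr \<alpha> * exp (- x)" if rt: "0 \<le> r" "r < t" "t \<le> 1" for r t
  proof -
    define k l where "k = 4 * (1 + m) * L * sqrt (t * (t - r))" and "l = 1 / k"
    have k: "0 < k"
      using rt L mass_nonneg by (simp add: k_def)
    have "s t * (s t - s r) \<le> (L * t) * (L * (t - r))"
      using L(2)[of 0 t] L(2)[of r t] rt s scale_diff_nonneg[of r t] L by (intro mult_mono) auto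
    then have "sqrt (s t * (s t - s r)) \<le> sqrt (L\<^sup>2 * (t * (t - r)))"
      by (simp add: power2_eq_square mult_ac)
    also have "\<dots> = L * sqrt (t * (t - r))"
      using L by (simp add: real_sqrt_mult)
    finally have "l * (1 + m) * sqrt (s t * (s t - s r)) \<le> l * (1 + m) * (L * sqrt (t * (t - r)))"
      using k mass_nonneg by (intro mult_left_mono) (auto simp: l_def)
    also have "\<dots> = l * (k / 4)"
      by (simp add: k_def mult_ac)
    also have "\<dots> = 1 / 4"
      using k by (simp add: l_def)
    finally have "measure N {w \<in> space N. x * k \<le> \<bar>X t w - X r w\<bar>} \<le> 2 * 2 powr \<alpha> * exp (- l * (x * k))"
      using rt k by (intro tail_increment) (auto simp: l_def)
    then show ?thesis
      unfolding k_def[symmetric] using k by (simp add: l_def)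
  qed
  show ?thesis
  proof (cases "r < t")
    case True
    then show ?thesis using *[of r t] rt by (simp add: max_def)
  next
    case False
    then show ?thesis using *[of t r] rt by (simp add: max_def abs_minus_commute)
  qed
qed

end

section \<open>Dyadic chaining\<close>

definition dyadic_floor :: "nat \<Rightarrow> real \<Rightarrow> real" where
  "dyadic_floor n t = of_int \<lfloor>2 ^ n * t\<rfloor> / 2 ^ n"

lemma dyadic_floor_bounds:
  "dyadic_floor n t \<le> t" "t - dyadic_floor n t < 1 / 2 ^ n"
proof -
  have "t * 2 ^ n < of_int \<lfloor>2 ^ n * t\<rfloor> + 1" "of_int \<lfloor>2 ^ n * t\<rfloor> \<le> t * 2 ^ n"
    using floor_correct[of "2 ^ n * t"] by (auto simp: mult.commute)
  then have "t < (of_int \<lfloor>2 ^ n * t\<rfloor> + 1) / 2 ^ n" "of_int \<lfloor>2 ^ n * t\<rfloor> / 2 ^ n \<le> t"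
    by (simp_all add: pos_less_divide_eq pos_divide_le_eq)
  then show "dyadic_floor n t \<le> t" "t - dyadic_floor n t < 1 / 2 ^ n"
    by (auto simp: dyadic_floor_def add_divide_distrib)
qed

lemma dyadic_floor_obtain:
  assumes "t \<in> {0..1}"
  obtains j where "j \<le> 2 ^ n" "dyadic_floor n t = real j / 2 ^ n" "\<lfloor>2 ^ n * t\<rfloor> = int j"
proof
  have nn: "0 \<le> \<lfloor>2 ^ n * t\<rfloor>"
    using assms by simp
  have "2 ^ n * t \<le> 2 ^ n"
    using assms by simp
  then have "\<lfloor>2 ^ n * t\<rfloor> \<le> 2 ^ n"
    using floor_mono[of "2 ^ n * t" "2 ^ n"] by simp
  then show "nat \<lfloor>2 ^ n * t\<rfloor> \<le> 2 ^ n"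
    by (simp add: nat_le_iff)
  show "dyadic_floor n t = real (nat \<lfloor>2 ^ n * t\<rfloor>) / 2 ^ n"
    using nn by (simp add: dyadic_floor_def)
  show "\<lfloor>2 ^ n * t\<rfloor> = int (nat \<lfloor>2 ^ n * t\<rfloor>)"
    using nn by simp
qed

lemma dyadic_floor_in: "t \<in> {0..1} \<Longrightarrow> dyadic_floor n t \<in> {0..1}"
proof (erule dyadic_floor_obtain[of _ n])
  fix j assume "j \<le> 2 ^ n" and *: "dyadic_floor n t = real j / 2 ^ n"
  then have "real j \<le> real (2 ^ n)"
    by (simp only: of_nat_le_iff)
  then show "dyadic_floor n t \<in> {0..1}"
    by (simp add: *)
qed

lemma dyadic_floor_tendsto: "(\<lambda>n. dyadic_floor n t) \<longlonglongrightarrow> t"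
proof (rule real_tendsto_sandwich[of "\<lambda>n. t - (1/2) ^ n" _ _ "\<lambda>_. t"])
  have "(\<lambda>n. t - (1/2) ^ n) \<longlonglongrightarrow> t - 0"
    by (intro tendsto_intros LIMSEQ_realpow_zero) auto
  then show "(\<lambda>n. t - (1/2) ^ n) \<longlonglongrightarrow> t" by simp
  show "\<forall>\<^sub>F n in sequentially. t - (1/2) ^ n \<le> dyadic_floor n t"
    using dyadic_floor_bounds(2)[of t] by (intro always_eventually allI) (simp add: power_divide less_imp_le algebra_simps)
qed (use dyadic_floor_bounds in auto)

section \<open>Deterministic chaining from bounds on dyadic increments\<close>

context
  fixes f :: "real \<Rightarrow> real" and w :: "nat \<Rightarrow> real" and n0 :: nat
  assumes incr: "\<And>l j. n0 \<le> l \<Longrightarrow> j < 2 ^ l \<Longrightarrow> \<bar>f (real (Suc j) / 2 ^ l) - f (real j / 2 ^ l)\<bar> \<le> w l"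
    and w: "\<And>l. 0 \<le> w l" "summable w"
begin

text \<open>If \<open>j\<close> is the index at level \<open>l\<close>, the index at level
  \<open>l + 1\<close> is \<open>2 * j\<close> or \<open>2 * j + 1\<close>; the two points coincide
  or are neighbours on the finer grid.\<close>

lemma dyadic_floor_Suc_diff:
  assumes t: "t \<in> {0..1}" and l: "n0 \<le> Suc l"
  shows "\<bar>f (dyadic_floor (Suc l) t) - f (dyadic_floor l t)\<bar> \<le> w (Suc l)"
proof -
  obtain j where j: "j \<le> 2 ^ l" "dyadic_floor l t = real j / 2 ^ l" "\<lfloor>2 ^ l * t\<rfloor> = int j"
    by (rule dyadic_floor_obtain[OF t])
  obtain k where k: "k \<le> 2 ^ Suc l" "dyadic_floor (Suc l) t = real k / 2 ^ Suc l" "\<lfloor>2 ^ Suc l * t\<rfloor> = int k"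
    by (rule dyadic_floor_obtain[OF t])
  have "int k = 2 * int j \<or> int k = 2 * int j + 1"
  proof -
    have "of_int (int j) \<le> 2 ^ l * t" "2 ^ l * t < of_int (int j) + 1"
      "of_int (int k) \<le> 2 ^ Suc l * t" "2 ^ Suc l * t < of_int (int k) + 1"
      using j(3) k(3) by linarith+
    then have "real_of_int (int k) < of_int (2 * int j + 2)" "real_of_int (2 * int j) < of_int (int k + 1)"
      by simp_all
    then show ?thesis
      unfolding of_int_less_iff by linarith
  qed
  then have "k = 2 * j \<or> k = Suc (2 * j)" by linarith
  then show ?thesis
  proof
    assume "k = 2 * j"
    then have "dyadic_floor (Suc l) t = dyadic_floor l t"
      using j k by simp
    then show ?thesis using w by simp
  next
    assume "k = Suc (2 * j)"
    then show ?thesis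
      using incr[OF l, of "2 * j"] k(1,2) j(2) by (simp add: mult.commute)
  qed
qed

lemma dyadic_limit:
  assumes t: "t \<in> {0..1}" and n: "n0 \<le> n"
  shows "convergent (\<lambda>l. f (dyadic_floor l t))"
    and "\<bar>lim (\<lambda>l. f (dyadic_floor l t)) - f (dyadic_floor n t)\<bar> \<le> (\<Sum>i. w (i + Suc n))"
proof -
  define y where "y l = f (dyadic_floor (l + n) t)" for l
  have d: "\<bar>y (Suc l) - y l\<bar> \<le> w (l + Suc n)" for l
    using dyadic_floor_Suc_diff[OF t, of "l + n"] n by (simp add: y_def)
  have sw: "summable (\<lambda>l. w (l + Suc n))"
    using w(2) by (rule summable_ignore_initial_segment)
  have sa: "summable (\<lambda>l. \<bar>y (Suc l) - y l\<bar>)"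
    by (rule summable_rabs_comparison_test[OF _ sw]) (use d in auto)
  then have s: "summable (\<lambda>l. y (Suc l) - y l)"
    by (rule summable_rabs_cancel)
  have "(\<lambda>k. \<Sum>l<k. y (Suc l) - y l) \<longlonglongrightarrow> (\<Sum>l. y (Suc l) - y l)"
    using s by (rule summable_LIMSEQ)
  then have "(\<lambda>k. y k - y 0) \<longlonglongrightarrow> (\<Sum>l. y (Suc l) - y l)"
    by (simp add: sum_lessThan_telescope)
  from tendsto_add[OF this tendsto_const[of "y 0"]]
  have "y \<longlonglongrightarrow> (\<Sum>l. y (Suc l) - y l) + y 0"
    by simp
  then have L: "(\<lambda>l. f (dyadic_floor l t)) \<longlonglongrightarrow> (\<Sum>l. y (Suc l) - y l) + y 0"
    unfolding y_def by (rule LIMSEQ_offset)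
  then show "convergent (\<lambda>l. f (dyadic_floor l t))"
    by (auto simp: convergent_def)
  have "\<bar>\<Sum>l. y (Suc l) - y l\<bar> \<le> (\<Sum>l. \<bar>y (Suc l) - y l\<bar>)"
    using sa by (rule summable_rabs)
  also have "\<dots> \<le> (\<Sum>l. w (l + Suc n))"
    using d sa sw by (intro suminf_le)
  finally show "\<bar>lim (\<lambda>l. f (dyadic_floor l t)) - f (dyadic_floor n t)\<bar> \<le> (\<Sum>i. w (i + Suc n))"
    using limI[OF L] by (simp add: y_def)
qed

text \<open>At level \<open>n\<close> the two floors are equal or adjacent, which costs
  \<open>w n\<close>; each limit then differs from its floor value by at most the tail after
  \<open>n\<close>.\<close>

lemma dyadic_limit_modulus:
  assumes t: "t \<in> {0..1}" "r \<in> {0..1}" "\<bar>t - r\<bar> \<le> 1 / 2 ^ n" and n: "n0 \<le> n"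
  shows "\<bar>lim (\<lambda>l. f (dyadic_floor l t)) - lim (\<lambda>l. f (dyadic_floor l r))\<bar> \<le>
    2 * (\<Sum>i. w (i + n))"
proof -
  have *: "\<bar>lim (\<lambda>l. f (dyadic_floor l t)) - lim (\<lambda>l. f (dyadic_floor l r))\<bar> \<le>
      2 * (\<Sum>i. w (i + n))" if t: "t \<in> {0..1}" "r \<in> {0..1}" "t - r \<le> 1 / 2 ^ n" "r \<le> t" for t r
  proof -
    obtain j where j: "j \<le> 2 ^ n" "dyadic_floor n t = real j / 2 ^ n" "\<lfloor>2 ^ n * t\<rfloor> = int j"
      by (rule dyadic_floor_obtain[OF t(1)])
    obtain k where k: "k \<le> 2 ^ n" "dyadic_floor n r = real k / 2 ^ n" "\<lfloor>2 ^ n * r\<rfloor> = int k"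
      by (rule dyadic_floor_obtain[OF t(2)])
    have "2 ^ n * r \<le> 2 ^ n * t" "2 ^ n * t \<le> 2 ^ n * r + 1"
      using t by (auto simp: field_simps)
    then have "j = k \<or> j = Suc k"
      using j(3) k(3) by linarith
    then have 1: "\<bar>f (dyadic_floor n t) - f (dyadic_floor n r)\<bar> \<le> w n"
      using incr[OF n, of k] j k w by auto
    have "(\<Sum>i. w (i + n)) = w n + (\<Sum>i. w (i + Suc n))"
      using suminf_split_head[of "\<lambda>i. w (i + n)"] summable_ignore_initial_segment[OF w(2), of n] by simp
    then show ?thesis
      using 1 dyadic_limit(2)[OF t(1) n] dyadic_limit(2)[OF t(2) n] w(1)[of n] by linarith
  qed
  show ?thesis
    using *[of t r] *[of r t] t by (cases "r \<le> t") (auto simp: abs_minus_commute)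
qed

lemma dyadic_limit_continuous: "continuous_on {0..1} (\<lambda>t. lim (\<lambda>l. f (dyadic_floor l t)))"
  unfolding continuous_on_iff
proof (intro ballI allI impI)
  fix t e :: real
  assume t: "t \<in> {0..1}" and "0 < e"
  obtain n1 where n1: "\<And>n. n1 \<le> n \<Longrightarrow> \<bar>\<Sum>i. w (i + n)\<bar> < e / 2"
    using suminf_exist_split[of "e/2" w] w(2) \<open>0 < e\<close> by auto
  define n where "n = max n0 n1"
  have "\<bar>lim (\<lambda>l. f (dyadic_floor l r)) - lim (\<lambda>l. f (dyadic_floor l t))\<bar> < e"
    if "r \<in> {0..1}" "\<bar>r - t\<bar> < 1 / 2 ^ n" for r
    using dyadic_limit_modulus[of r t n] n1[of n] that t by (auto simp: n_def)
  then show "\<exists>d>0. \<forall>r\<in>{0..1}. dist r t < d \<longrightarrow>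
      dist (lim (\<lambda>l. f (dyadic_floor l r))) (lim (\<lambda>l. f (dyadic_floor l t))) < e"
    by (intro exI[of _ "1 / 2 ^ n"]) (auto simp: dist_real_def)
qed

text \<open>Every \<open>t\<close> below 1 has level-0 floor 0, so chaining from level 0 compares
  \<open>f t\<close> directly with \<open>f 0\<close>. The point 1 is its own level-0 floor and is
  covered by the single increment of level 0.\<close>

lemma dyadic_oscillation:
  assumes cont: "continuous_on {0..1} f" and n0: "n0 = 0" and t: "t \<in> {0..1}"
  shows "\<bar>f t - f 0\<bar> \<le> (\<Sum>i. w i)"
proof (cases "t = 1")
  case True
  then show ?thesis
    using incr[of 0 0] n0 sum_le_suminf[OF w(2), of "{0}"] w(1) by auto
next
  case False
  have "(\<lambda>l. f (dyadic_floor l t)) \<longlonglongrightarrow> f t"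
    using t dyadic_floor_in[OF t] by (intro continuous_on_tendsto_compose[OF cont dyadic_floor_tendsto]) auto
  then have "lim (\<lambda>l. f (dyadic_floor l t)) = f t"
    by (rule limI)
  moreover have "dyadic_floor 0 t = 0"
    using False t by (simp add: dyadic_floor_def floor_eq_iff)
  ultimately have "\<bar>f t - f 0\<bar> \<le> (\<Sum>i. w (i + Suc 0))"
    using dyadic_limit(2)[OF t, of 0] n0 by simp
  also have "\<dots> \<le> (\<Sum>i. w i)"
    using suminf_split_head[OF w(2)] w(1)[of 0] by simp
  finally show ?thesis .
qed

end

section \<open>Chaining for the random process\<close>

text \<open>Increments at level \<open>n\<close> have scale \<open>sqrt (1/2) ^ n\<close>, and a
  threshold proportional to \<open>n + 1\<close> outweighs the union over \<open>2 ^ n\<close> of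
  them when the proportionality factor is large enough; these products must be summable for the
  chaining to converge.\<close>

lemma summable_linear_geometric:
  "summable (\<lambda>n. real (Suc n) * sqrt (1/2) ^ n)"
proof -
  have "sqrt (1/2) < sqrt 1" by (intro real_sqrt_less_mono) simp
  then have "norm (sqrt (1/2)) < 1" by simp
  from sums_summable[OF geometric_deriv_sums[OF this]] show ?thesis .
qed

context prob_space
begin

context
  fixes X :: "real \<Rightarrow> 'a \<Rightarrow> real" and \<kappa> C :: real
  assumes meas: "\<And>t. t \<in> {0..1} \<Longrightarrow> X t \<in> borel_measurable M"
    and const: "0 < \<kappa>" "0 \<le> C"
    and tail: "\<And>r t x. r \<in> {0..1} \<Longrightarrow> t \<in> {0..1} \<Longrightarrow> r \<noteq> t \<Longrightarrow>
      prob {w \<in> space M. x * (\<kappa> * sqrt (max r t * \<bar>t - r\<bar>)) \<le> \<bar>X t w - X r w\<bar>} \<le> C * exp (- x)"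
begin

lemma tail_increment_le:
  assumes "r \<in> {0..1}" "t \<in> {0..1}" "r \<noteq> t" "0 \<le> x" "\<kappa> * sqrt (max r t * \<bar>t - r\<bar>) \<le> h"
  shows "prob {w \<in> space M. x * h \<le> \<bar>X t w - X r w\<bar>} \<le> C * exp (- x)"
proof -
  have [measurable]: "X t \<in> borel_measurable M" "X r \<in> borel_measurable M"
    using meas assms by auto
  have "prob {w \<in> space M. x * h \<le> \<bar>X t w - X r w\<bar>} \<le>
      prob {w \<in> space M. x * (\<kappa> * sqrt (max r t * \<bar>t - r\<bar>)) \<le> \<bar>X t w - X r w\<bar>}"
    using mult_left_mono[OF assms(5,4)] by (intro finite_measure_mono) auto
  then show ?thesis
    using tail[OF assms(1-3), of x] by linarith
qed

text \<open>After rescaling to the unit interval, each of the \<open>2 ^ l\<close> increments has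
  length \<open>(b - a) / 2 ^ l\<close> and both endpoints at most \<open>b\<close>, which gives the
  common scale; then a union bound. Keeping the factor \<open>sqrt b\<close> is essential for blocks
  close to 0.\<close>

lemma grid_increments_tail:
  fixes a b x :: real
  assumes ab: "0 \<le> a" "a < b" "b \<le> 1" and x: "0 \<le> x"
  defines "Z \<equiv> \<lambda>u. X (a + (b - a) * u)"
  shows "{w \<in> space M. \<exists>j<2^l. x * (\<kappa> * sqrt (b * (b - a)) * sqrt (1/2) ^ l) \<le>
      \<bar>Z (real (Suc j) / 2 ^ l) w - Z (real j / 2 ^ l) w\<bar>} \<in> events" (is "?E \<in> _")
    and "prob {w \<in> space M. \<exists>j<2^l. x * (\<kappa> * sqrt (b * (b - a)) * sqrt (1/2) ^ l) \<le>
      \<bar>Z (real (Suc j) / 2 ^ l) w - Z (real j / 2 ^ l) w\<bar>} \<le> 2 ^ l * (C * exp (- x))"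
proof -
  let ?h = "\<kappa> * sqrt (b * (b - a)) * sqrt (1/2) ^ l"
  let ?e = "\<lambda>j. {w \<in> space M. x * ?h \<le> \<bar>Z (real (Suc j) / 2 ^ l) w - Z (real j / 2 ^ l) w\<bar>}"
  have pt: "a + (b - a) * (real j / 2 ^ l) \<in> {0..1}" "a + (b - a) * (real j / 2 ^ l) \<le> b" if "j \<le> 2 ^ l" for j
  proof -
    have "real j / 2 ^ l \<le> 1"
      using of_nat_mono[OF that, where 'a=real] by simp
    then have "(b - a) * (real j / 2 ^ l) \<le> (b - a) * 1"
      using ab by (intro mult_left_mono) auto
    then show "a + (b - a) * (real j / 2 ^ l) \<in> {0..1}" "a + (b - a) * (real j / 2 ^ l) \<le> b"
      using ab by auto
  qed
  have ev: "?e j \<in> events" if "j < 2 ^ l" for j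
  proof -
    have [measurable]: "Z (real (Suc j) / 2 ^ l) \<in> borel_measurable M" "Z (real j / 2 ^ l) \<in> borel_measurable M"
      unfolding Z_def using that by (intro meas pt(1); simp)+
    show ?thesis by measurable
  qed
  have eq: "?E = (\<Union>j\<in>{..<2^l}. ?e j)" by auto
  show "?E \<in> events"
    unfolding eq by (intro sets.finite_UN finite_lessThan ev) simp
  have pr: "prob (?e j) \<le> C * exp (- x)" if j: "j < 2 ^ l" for j
    unfolding Z_def
  proof (rule tail_increment_le)
    let ?r = "a + (b - a) * (real j / 2 ^ l)" and ?t = "a + (b - a) * (real (Suc j) / 2 ^ l)"
    show "?r \<in> {0..1}" "?t \<in> {0..1}"
      using j by (intro pt(1); simp)+
    have d: "?t - ?r = (b - a) / 2 ^ l"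
      by (simp add: field_simps)
    moreover have "0 < (b - a) / 2 ^ l"
      using ab by simp
    ultimately show "?r \<noteq> ?t" by auto
    have "max ?r ?t * \<bar>?t - ?r\<bar> \<le> b * ((b - a) / 2 ^ l)"
      unfolding d using ab pt[of j] pt[of "Suc j"] j by (intro mult_mono) auto
    then have "sqrt (max ?r ?t * \<bar>?t - ?r\<bar>) \<le> sqrt (b * (b - a) * (1/2) ^ l)"
      by (simp add: power_divide)
    then have "\<kappa> * sqrt (max ?r ?t * \<bar>?t - ?r\<bar>) \<le> \<kappa> * sqrt (b * (b - a) * (1/2) ^ l)"
      using const by (intro mult_left_mono) auto
    then show "\<kappa> * sqrt (max ?r ?t * \<bar>?t - ?r\<bar>) \<le> ?h"
      by (simp add: real_sqrt_mult real_sqrt_power mult.assoc)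
  qed (rule x)
  have "prob ?E \<le> (\<Sum>j\<in>{..<2^l}. prob (?e j))"
    unfolding eq by (intro finite_measure_subadditive_finite finite_lessThan image_subsetI ev) simp
  also have "\<dots> \<le> (\<Sum>j\<in>{..<2^l::nat}. C * exp (- x))"
    by (intro sum_mono pr) simp
  finally show "prob ?E \<le> 2 ^ l * (C * exp (- x))"
    by simp
qed

text \<open>Borel-Cantelli with threshold parameter \<open>n + 1\<close> at level \<open>n\<close>.
  This identifies the pathwise limit along dyadic points with the original variable at each fixed
  time, including non-dyadic ones.\<close>

lemma AE_dyadic_floor_tendsto:
  assumes t: "t \<in> {0..1}"
  shows "AE w in M. (\<lambda>n. X (dyadic_floor n t) w) \<longlonglongrightarrow> X t w"
proof -
  let ?h = "\<lambda>n. real (Suc n) * (\<kappa> * sqrt (1/2) ^ n)"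
  let ?A = "\<lambda>n. {w \<in> space M. ?h n \<le> \<bar>X t w - X (dyadic_floor n t) w\<bar>}"
  have [measurable]: "X t \<in> borel_measurable M" "X (dyadic_floor n t) \<in> borel_measurable M" for n
    using meas t dyadic_floor_in[OF t] by auto
  have pr: "prob (?A n) \<le> C * exp (- 1) ^ Suc n" for n
  proof (cases "dyadic_floor n t = t")
    case True
    \<comment> \<open>The increment tail is given for distinct times only; for equal times the
      increment is 0 and misses the positive threshold.\<close>
    have "0 < ?h n" using const by simp
    then have "?A n = {}" by (auto simp: True not_le)
    then have "prob (?A n) = 0" by (simp only: measure_empty)
    then show ?thesis using const by simp
  next
    case False
    have "prob (?A n) \<le> C * exp (- real (Suc n))"
    proof (rule tail_increment_le)
      have "max (dyadic_floor n t) t * \<bar>t - dyadic_floor n t\<bar> \<le> 1 * (1/2) ^ n"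
        using dyadic_floor_bounds[where n=n and t=t] t dyadic_floor_in[OF t, of n]
        by (intro mult_mono) (auto simp: power_divide)
      then have "sqrt (max (dyadic_floor n t) t * \<bar>t - dyadic_floor n t\<bar>) \<le> sqrt ((1/2) ^ n)"
        by simp
      then show "\<kappa> * sqrt (max (dyadic_floor n t) t * \<bar>t - dyadic_floor n t\<bar>) \<le> \<kappa> * sqrt (1/2) ^ n"
        using const by (simp add: real_sqrt_power)
    qed (use t dyadic_floor_in[OF t] False in auto)
    then show ?thesis
      by (simp only: exp_of_nat_mult[symmetric]) simp
  qed
  have "AE w in M. \<forall>\<^sub>F n in sequentially. w \<in> space M - ?A n"
  proof (rule borel_cantelli_AE1)
    have "summable (\<lambda>n. C * exp (- 1 :: real) ^ Suc n)"
      by (intro summable_mult summable_ignore_initial_segment[of _ 1, simplified] summable_geometric) auto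
    then show "summable (\<lambda>n. prob (?A n))"
      by (rule summable_comparison_test') (use pr in auto)
  qed (auto simp: emeasure_eq_measure)
  then show ?thesis
  proof eventually_elim
    case (elim w)
    have "summable (\<lambda>n. \<kappa> * (real (Suc n) * sqrt (1/2) ^ n))"
      by (intro summable_mult summable_linear_geometric)
    then have h0: "?h \<longlonglongrightarrow> 0"
      by (intro summable_LIMSEQ_zero) (simp add: mult_ac)
    have "(\<lambda>n. X (dyadic_floor n t) w - X t w) \<longlonglongrightarrow> 0"
      by (rule Lim_null_comparison[OF _ h0]) (use elim in eventually_elim, auto simp: abs_minus_commute)
    then show ?case
      by (simp add: LIM_zero_iff)
  qed
qed

text \<open>At level \<open>l\<close> the threshold parameter is \<open>2 * (l + 1)\<close>, so the
  union bound is geometric with ratio \<open>2 * exp (- 2) < 1\<close>. Almost surely all increments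
  are controlled from some level on, depending on the path, and this suffices for
  continuity.\<close>

lemma continuous_version_exists:
  defines "Y \<equiv> \<lambda>t w. lim (\<lambda>n. X (dyadic_floor n t) w)"
  shows "is_version {0..1} M X Y" "AE w in M. continuous_on {0..1} (\<lambda>t. Y t w)"
proof -
  show "is_version {0..1} M X Y"
    unfolding is_version_def
  proof (intro ballI conjI)
    fix t :: real assume t: "t \<in> {0..1}"
    show "Y t \<in> borel_measurable M"
      unfolding Y_def using meas dyadic_floor_in[OF t] by (intro borel_measurable_lim_metric) auto
    show "AE w in M. Y t w = X t w"
      using AE_dyadic_floor_tendsto[OF t] by eventually_elim (simp add: Y_def limI)
  qed
  let ?w = "\<lambda>l. 2 * real (Suc l) * (\<kappa> * sqrt (1/2) ^ l)"
  define A where "A l = {w \<in> space M. \<exists>j<2^l. ?w l \<le> \<bar>X (real (Suc j) / 2 ^ l) w - X (real j / 2 ^ l) w\<bar>}" for l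
  have E: "A l \<in> events" "prob (A l) \<le> 2 ^ l * (C * exp (- (2 * real (Suc l))))" for l
    using grid_increments_tail[of 0 1 "2 * real (Suc l)" l]
    unfolding A_def by (simp_all only: diff_zero add_0 mult_1 mult_1_right real_sqrt_one
        order_refl zero_less_one zero_le_numeral of_nat_0_le_iff mult_nonneg_nonneg simp_thms)
  have "AE w in M. \<forall>\<^sub>F l in sequentially. w \<in> space M - A l"
  proof (rule borel_cantelli_AE1)
    have e: "exp (- 2 :: real) < 1 / 2"
      using exp_ge_add_one_self[of "2::real"] by (simp add: exp_minus field_simps)
    have "summable (\<lambda>l. C * exp (- 2) * (2 * exp (- 2 :: real)) ^ l)"
      using e by (intro summable_mult summable_geometric) auto
    moreover have "norm (prob (A l)) \<le> C * exp (- 2) * (2 * exp (- 2 :: real)) ^ l" for l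
    proof -
      have "exp (- (2 * real (Suc l))) = exp (- 2) * exp (- 2) ^ l"
        by (simp add: exp_of_nat_mult[symmetric] exp_add[symmetric] algebra_simps)
      then have "2 ^ l * (C * exp (- (2 * real (Suc l)))) = C * exp (- 2) * (2 * exp (- 2 :: real)) ^ l"
        by (simp add: power_mult_distrib mult_ac)
      then show ?thesis
        using E(2)[of l] by (simp only: real_norm_def abs_of_nonneg[OF measure_nonneg])
    qed
    ultimately show "summable (\<lambda>l. prob (A l))"
      by (rule summable_comparison_test')
  qed (use E in \<open>auto simp: emeasure_eq_measure\<close>)
  then show "AE w in M. continuous_on {0..1} (\<lambda>t. Y t w)"
  proof eventually_elim
    case (elim w)
    then obtain n0 where n0: "\<And>l. n0 \<le> l \<Longrightarrow> w \<in> space M - A l"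
      by (auto simp: eventually_sequentially)
    show ?case
      unfolding Y_def
    proof (rule dyadic_limit_continuous[of n0 _ ?w])
      show "\<bar>X (real (Suc j) / 2 ^ l) w - X (real j / 2 ^ l) w\<bar> \<le> ?w l" if "n0 \<le> l" "j < 2 ^ l" for l j
        using n0[OF that(1)] that(2) by (auto simp: A_def not_le less_imp_le)
      show "0 \<le> ?w l" for l using const by simp
      have "summable (\<lambda>l. 2 * \<kappa> * (real (Suc l) * sqrt (1/2) ^ l))"
        by (intro summable_mult summable_linear_geometric)
      also have "(\<lambda>l. 2 * \<kappa> * (real (Suc l) * sqrt (1/2) ^ l)) = ?w"
        by (simp only: mult_ac)
      finally show "summable ?w" .
    qed
  qed
qed

text \<open>Here every level from 0 on must be controlled, since a quantitative bound is wanted;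
  \<open>G\<close> is the union of all bad events. The condition \<open>2 \<le> x\<close> gives
  \<open>2 * exp (- x) \<le> 1 / 2\<close>, so the levels sum to at most twice the bound of level
  0.\<close>

lemma oscillation_tail:
  fixes a b x :: real
  assumes ab: "0 \<le> a" "a < b" "b \<le> 1" and x: "2 \<le> x"
    and cont: "AE w in M. continuous_on {0..1} (\<lambda>t. X t w)"
  defines "S \<equiv> (\<Sum>n. real (Suc n) * sqrt (1/2) ^ n)"
  obtains G where "G \<in> events" "prob G \<le> 2 * C * exp (- x)"
    "AE w in M. w \<notin> G \<longrightarrow> (\<forall>t\<in>{a..b}. \<bar>X t w - X a w\<bar> \<le> x * \<kappa> * sqrt (b * (b - a)) * S)"
proof -
  define Z where "Z u = X (a + (b - a) * u)" for u
  define h where "h l = x * real (Suc l) * (\<kappa> * sqrt (b * (b - a)) * sqrt (1/2) ^ l)" for l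
  define A where "A l = {w \<in> space M. \<exists>j<2^l. h l \<le> \<bar>Z (real (Suc j) / 2 ^ l) w - Z (real j / 2 ^ l) w\<bar>}" for l
  have A: "A l \<in> events" "prob (A l) \<le> 2 ^ l * (C * exp (- (x * real (Suc l))))" for l
    unfolding A_def h_def Z_def by (intro grid_increments_tail ab; use x in simp)+
  have e: "exp (- x) \<le> 1 / 4"
  proof -
    have "exp (- x) \<le> exp (- 2)" using x by simp
    also have "exp (- 2 :: real) = (1 / exp 1) ^ 2"
      using exp_of_nat_mult[of 2 "1::real"] by (simp add: power_divide exp_minus field_simps)
    also have "\<dots> \<le> (1 / 2) ^ 2"
      using exp_ge_add_one_self[of "1::real"] by (intro power_mono) (auto simp: field_simps)
    finally show ?thesis by (simp add: power2_eq_square)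
  qed
  have A': "prob (A l) \<le> C * exp (- x) * (1 / 2) ^ l" for l
  proof -
    have "exp (- (x * real (Suc l))) = exp (- x) * exp (- x) ^ l"
      by (simp add: exp_of_nat_mult[symmetric] exp_add[symmetric] algebra_simps)
    then have "2 ^ l * (C * exp (- (x * real (Suc l)))) = C * exp (- x) * (2 * exp (- x)) ^ l"
      by (simp add: power_mult_distrib mult_ac)
    also have "\<dots> \<le> C * exp (- x) * (1 / 2) ^ l"
      using e const by (intro mult_left_mono power_mono) auto
    finally show ?thesis
      using A(2)[of l] by linarith
  qed
  have sg: "(\<lambda>l. C * exp (- x) * (1 / 2) ^ l) sums (C * exp (- x) * 2)"
    using geometric_sums[of "1/2::real"] by (intro sums_mult) simp
  have sA: "summable (\<lambda>l. prob (A l))"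
    by (rule summable_comparison_test'[of _ 0, OF sums_summable[OF sg]]) (use A' in auto)
  show ?thesis
  proof
    show "(\<Union>l. A l) \<in> events"
      using A by auto
    have "prob (\<Union>l. A l) \<le> (\<Sum>l. prob (A l))"
      using A sA by (intro finite_measure_subadditive_countably) auto
    also have "\<dots> \<le> C * exp (- x) * 2"
      using sA A' sg by (intro sums_le[OF A' summable_sums sg])
    finally show "prob (\<Union>l. A l) \<le> 2 * C * exp (- x)"
      by (simp add: mult_ac)
    show "AE w in M. w \<notin> (\<Union>l. A l) \<longrightarrow>
        (\<forall>t\<in>{a..b}. \<bar>X t w - X a w\<bar> \<le> x * \<kappa> * sqrt (b * (b - a)) * S)"
      using cont AE_space
    proof eventually_elim
      case (elim w)
      show ?case
      proof (intro impI ballI)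
        fix t assume nA: "w \<notin> (\<Union>l. A l)" and t: "t \<in> {a..b}"
        define u where "u = (t - a) / (b - a)"
        have u: "u \<in> {0..1}" "a + (b - a) * u = t"
          using t ab by (auto simp: u_def field_simps)
        have sh: "h sums (x * \<kappa> * sqrt (b * (b - a)) * S)"
          using sums_mult[OF summable_sums[OF summable_linear_geometric], of "x * \<kappa> * sqrt (b * (b - a))"]
          by (simp add: h_def[abs_def] S_def mult_ac)
        have "\<bar>Z u w - Z 0 w\<bar> \<le> (\<Sum>l. h l)"
        proof (rule dyadic_oscillation[of 0 "\<lambda>u. Z u w"])
          show "\<bar>Z (real (Suc j) / 2 ^ l) w - Z (real j / 2 ^ l) w\<bar> \<le> h l" if "j < 2 ^ l" for l j
            using nA elim that by (auto simp: A_def not_le less_imp_le)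
          show "0 \<le> h l" for l
            using x const ab by (auto simp: h_def)
          have "a + (b - a) * u \<in> {0..1}" if "u \<in> {0..1}" for u
          proof -
            have "a + (b - a) * u \<le> a + (b - a) * 1"
              using ab that by (intro add_left_mono mult_left_mono) auto
            also have "\<dots> \<le> 1"
              using ab by simp
            finally have "a + (b - a) * u \<le> 1" .
            moreover have "0 \<le> (b - a) * u"
              using ab that by simp
            ultimately show ?thesis
              using ab(1) by (simp only: atLeastAtMost_iff add_nonneg_nonneg simp_thms)
          qed
          then show "continuous_on {0..1} (\<lambda>u. Z u w)"
            unfolding Z_def by (intro continuous_on_compose2[OF elim(1)] continuous_intros) blast
        qed (use sh u in \<open>auto simp: sums_iff\<close>)
        then show "\<bar>X t w - X a w\<bar> \<le> x * \<kappa> * sqrt (b * (b - a)) * S"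
          using u sh by (simp add: Z_def sums_iff)
      qed
    qed
  qed
qed

section \<open>The law of the iterated logarithm\<close>

text \<open>On the block between \<open>\<theta> ^ Suc k\<close> and \<open>\<theta> ^ k\<close>,
  the value at the left end contributes \<open>(1 + \<eta>) * A\<close> and the oscillation
  contributes the second summand. The left end is the reference point because \<open>s\<close> is
  smallest there, so both estimates are relative to a lower bound of the denominator.\<close>

lemma limsup_bound_geometric:
  fixes s :: "real \<Rightarrow> real" and A c t0 D \<eta> \<theta> :: real
  assumes cont: "AE w in M. continuous_on {0..1} (\<lambda>t. X t w)"
    and s: "mono s" "0 < c" "0 < t0" "\<And>t. 0 < t \<Longrightarrow> t \<le> t0 \<Longrightarrow> c * t \<le> s t"
    and A: "0 < A" and \<eta>: "0 < \<eta>" and \<theta>: "0 < \<theta>" "\<theta> < 1" and D: "0 \<le> D"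
    and one: "\<And>t x. 0 < t \<Longrightarrow> t \<le> 1 \<Longrightarrow>
      prob {w \<in> space M. (1 + \<eta>) * x * (A * s t) \<le> X t w} \<le> D * exp (- (1 + \<eta> / 2) * x)"
  defines "S \<equiv> (\<Sum>n. real (Suc n) * sqrt (1/2) ^ n)"
  shows "AE w in M. Limsup (at_right 0) (\<lambda>t. ereal (X t w / (s t * ln (ln (1 / t))))) \<le>
    ereal ((1 + \<eta>) * A + 2 * \<kappa> * S * sqrt (1 - \<theta>) / (\<theta> * c))"
proof -
  define q where "q = ln (1 / \<theta>)"
  have q: "0 < q"
    using \<theta> by (simp add: q_def)
  \<comment> \<open>The iterated logarithm \<open>ln (ln (1 / t))\<close> at the right end
    \<open>t = \<theta> ^ k\<close>.\<close>
  define \<Lambda> where "\<Lambda> k = ln (real k * q)" for k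
  define a b where "a k = \<theta> ^ Suc k" and "b k = \<theta> ^ k" for k
  have ab: "0 < a k" "a k < b k" "b k \<le> 1" "a k = \<theta> * b k" "0 < b k" for k
    using \<theta> by (auto simp: a_def b_def power_le_one)
  obtain k2 where k2: "\<theta> ^ k2 < t0"
    using real_arch_pow_inv[of t0 \<theta>] s \<theta> by auto
  \<comment> \<open>From this index on \<open>real k * q\<close> is at least \<open>exp 1\<close>,
    hence \<open>\<Lambda> k \<ge> 1\<close>: the denominator is positive and
    \<open>2 * \<Lambda> k\<close> is admissible in the oscillation bound.\<close>
  obtain k3 where k3: "exp 1 / q < real k3"
    using reals_Archimedean2 by blast
  define k1 where "k1 = max k2 k3"
  have bt0: "b k \<le> t0" if "k1 \<le> k" for k
  proof -
    have "\<theta> ^ k \<le> \<theta> ^ k2"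
      using \<theta> that by (intro power_decreasing) (auto simp: k1_def)
    then show ?thesis using k2 by (simp add: b_def)
  qed
  have kq: "exp 1 \<le> real k * q" if "k1 \<le> k" for k
  proof -
    have "exp 1 / q \<le> real k"
      using k3 that by (simp add: k1_def)
    then show ?thesis
      using q by (simp add: field_simps)
  qed
  have \<Lambda>: "1 \<le> \<Lambda> k" if "k1 \<le> k" for k
    using ln_mono[OF kq[OF that]] by (simp add: \<Lambda>_def)
  have expL: "exp (- p * \<Lambda> k) = q powr - p * real k powr - p" if "k1 \<le> k" for k p
  proof -
    have "0 < real k * q"
      using kq[OF that] exp_gt_zero[of "1::real"] by linarith
    then have "exp (- p * \<Lambda> k) = (real k * q) powr - p"
      unfolding \<Lambda>_def powr_def by (simp only: if_False order_less_imp_not_eq2)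
    also have "\<dots> = q powr - p * real k powr - p"
      using q by (simp add: powr_mult)
    finally show ?thesis .
  qed
  have "\<forall>k. \<exists>G. k1 \<le> k \<longrightarrow> G \<in> events \<and> prob G \<le> 2 * C * exp (- (2 * \<Lambda> k)) \<and>
      (AE w in M. w \<notin> G \<longrightarrow> (\<forall>t\<in>{a k..b k}. \<bar>X t w - X (a k) w\<bar> \<le> 2 * \<Lambda> k * \<kappa> * sqrt (b k * (b k - a k)) * S))"
  proof
    fix k
    show "\<exists>G. k1 \<le> k \<longrightarrow> G \<in> events \<and> prob G \<le> 2 * C * exp (- (2 * \<Lambda> k)) \<and>
      (AE w in M. w \<notin> G \<longrightarrow> (\<forall>t\<in>{a k..b k}. \<bar>X t w - X (a k) w\<bar> \<le> 2 * \<Lambda> k * \<kappa> * sqrt (b k * (b k - a k)) * S))"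
    proof (cases "k1 \<le> k")
      case True
      then have x: "2 \<le> 2 * \<Lambda> k" using \<Lambda> by simp
      obtain G where "G \<in> events" "prob G \<le> 2 * C * exp (- (2 * \<Lambda> k))"
        "AE w in M. w \<notin> G \<longrightarrow> (\<forall>t\<in>{a k..b k}. \<bar>X t w - X (a k) w\<bar> \<le>
          2 * \<Lambda> k * \<kappa> * sqrt (b k * (b k - a k)) * (\<Sum>n. real (Suc n) * sqrt (1/2) ^ n))"
        by (rule oscillation_tail[OF less_imp_le[OF ab(1)] ab(2,3) x cont])
      then show ?thesis unfolding S_def by (intro exI[of _ G] impI conjI)
    qed auto
  qed
  from choice[OF this] obtain G where G: "\<And>k. k1 \<le> k \<Longrightarrow> G k \<in> events"
    "\<And>k. k1 \<le> k \<Longrightarrow> prob (G k) \<le> 2 * C * exp (- (2 * \<Lambda> k))"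
    "\<And>k. k1 \<le> k \<Longrightarrow> AE w in M. w \<notin> G k \<longrightarrow>
        (\<forall>t\<in>{a k..b k}. \<bar>X t w - X (a k) w\<bar> \<le> 2 * \<Lambda> k * \<kappa> * sqrt (b k * (b k - a k)) * S)"
    by blast
  define H where "H k = {w \<in> space M. (1 + \<eta>) * \<Lambda> k * (A * s (a k)) \<le> X (a k) w}" for k
  have a1: "a k \<le> 1" for k
    using ab[of k] by linarith
  have H: "H k \<in> events" "prob (H k) \<le> D * exp (- (1 + \<eta> / 2) * \<Lambda> k)" for k
  proof -
    have [measurable]: "X (a k) \<in> borel_measurable M"
      using ab[of k] a1[of k] by (intro meas) auto
    show "H k \<in> events" unfolding H_def by measurable
    show "prob (H k) \<le> D * exp (- (1 + \<eta> / 2) * \<Lambda> k)"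
      unfolding H_def using ab[of k] a1[of k] by (intro one) auto
  qed
  have "AE w in M. \<forall>\<^sub>F j in sequentially. w \<in> space M - (G (j + k1) \<union> H (j + k1))"
  proof (rule borel_cantelli_AE1)
    define B where "B k = 2 * C * (q powr - 2 * real k powr - 2) +
      D * (q powr - (1 + \<eta> / 2) * real k powr - (1 + \<eta> / 2))" for k
    \<comment> \<open>Exponentials of multiples of \<open>\<Lambda> k\<close> are powers of
      \<open>k\<close>: exponent 2 for the oscillations and \<open>1 + \<eta> / 2\<close> for the
      left ends, both larger than 1.\<close>
    have "summable B"
      unfolding B_def using \<eta> by (intro summable_add summable_mult) (simp_all add: summable_real_powr_iff)
    then have "summable (\<lambda>j. B (j + k1))"
      by (rule summable_ignore_initial_segment)
    moreover have "norm (prob (G (j + k1) \<union> H (j + k1))) \<le> B (j + k1)" for j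
    proof -
      have k: "k1 \<le> j + k1" by simp
      have "prob (G (j + k1) \<union> H (j + k1)) \<le> prob (G (j + k1)) + prob (H (j + k1))"
        using G(1)[OF k] H(1) by (rule measure_Un_le)
      also have "\<dots> \<le> B (j + k1)"
        unfolding B_def using G(2)[OF k] H(2)[of "j + k1"] expL[OF k, of 2] expL[OF k, of "1 + \<eta> / 2"]
        by simp
      finally show ?thesis by simp
    qed
    ultimately show "summable (\<lambda>j. prob (G (j + k1) \<union> H (j + k1)))"
      by (rule summable_comparison_test')
  qed (use G(1) H(1) in \<open>auto simp: emeasure_eq_measure\<close>)
  moreover have "AE w in M. \<forall>j. w \<notin> G (j + k1) \<longrightarrow> (\<forall>t\<in>{a (j + k1)..b (j + k1)}.
      \<bar>X t w - X (a (j + k1)) w\<bar> \<le> 2 * \<Lambda> (j + k1) * \<kappa> * sqrt (b (j + k1) * (b (j + k1) - a (j + k1))) * S)"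
    unfolding AE_all_countable using G(3) by simp
  ultimately show ?thesis
  proof eventually_elim
    case (elim w)
    let ?B = "(1 + \<eta>) * A + 2 * \<kappa> * S * sqrt (1 - \<theta>) / (\<theta> * c)"
    obtain J where J: "\<And>j. J \<le> j \<Longrightarrow> w \<in> space M - (G (j + k1) \<union> H (j + k1))"
      using elim(1) by (auto simp: eventually_sequentially)
    have S0: "0 \<le> S"
      unfolding S_def by (intro suminf_nonneg summable_linear_geometric) auto
    have block: "X t w / (s t * ln (ln (1 / t))) \<le> ?B"
      if k: "J + k1 \<le> k" and t: "a k \<le> t" "t \<le> b k" for k t
    proof -
      obtain j where j: "J \<le> j" "k = j + k1"
        using k by (metis add.commute le_Suc_ex nat_le_iff_add add.assoc le_add1)
      have k1: "k1 \<le> k" using k by simp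
      have w: "w \<notin> G k" "X (a k) w < (1 + \<eta>) * \<Lambda> k * (A * s (a k))"
        using J[OF j(1)] by (auto simp: H_def j(2))
      have sa: "c * a k \<le> s (a k)" "0 < s (a k)"
      proof -
        have "a k \<le> t0"
          using bt0[OF k1] ab[of k] by linarith
        then show "c * a k \<le> s (a k)"
          using s(4) ab(1) by blast
        then show "0 < s (a k)"
          using mult_pos_pos[OF s(2) ab(1)[of k]] by linarith
      qed
      \<comment> \<open>Since \<open>a k = \<theta> * b k\<close>, the scale is
        \<open>b k * sqrt (1 - \<theta>)\<close>, and the linear lower bound on \<open>s\<close>
        expresses \<open>b k\<close> through \<open>s (a k)\<close>.\<close>
      have "sqrt (b k * (b k - a k)) = sqrt ((b k)\<^sup>2 * (1 - \<theta>))"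
        by (simp add: ab(4) power2_eq_square algebra_simps)
      also have "\<dots> = b k * sqrt (1 - \<theta>)"
        using ab(5)[of k] by (simp add: real_sqrt_mult)
      also have "\<dots> = (c * a k) * (sqrt (1 - \<theta>) / (\<theta> * c))"
        using \<theta> s(2) by (simp add: ab(4))
      also have "\<dots> \<le> s (a k) * (sqrt (1 - \<theta>) / (\<theta> * c))"
        using sa \<theta> s(2) by (intro mult_right_mono) auto
      finally have sq: "sqrt (b k * (b k - a k)) \<le> s (a k) * (sqrt (1 - \<theta>) / (\<theta> * c))" .
      have "X t w \<le> X (a k) w + 2 * \<Lambda> k * \<kappa> * sqrt (b k * (b k - a k)) * S"
      proof -
        have "\<bar>X t w - X (a k) w\<bar> \<le> 2 * \<Lambda> k * \<kappa> * sqrt (b k * (b k - a k)) * S"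
          using elim(2) w(1) t unfolding j(2) by auto
        then show ?thesis by linarith
      qed
      also have "2 * \<Lambda> k * \<kappa> * sqrt (b k * (b k - a k)) * S =
          (2 * \<Lambda> k * \<kappa> * S) * sqrt (b k * (b k - a k))"
        by (simp add: mult_ac)
      also have "\<dots> \<le> (2 * \<Lambda> k * \<kappa> * S) * (s (a k) * (sqrt (1 - \<theta>) / (\<theta> * c)))"
        using \<Lambda>[OF k1] const S0 by (intro mult_left_mono sq) simp
      also have "X (a k) w + \<dots> \<le> (1 + \<eta>) * \<Lambda> k * (A * s (a k)) +
          (2 * \<Lambda> k * \<kappa> * S) * (s (a k) * (sqrt (1 - \<theta>) / (\<theta> * c)))"
        using w(2) by simp
      also have "\<dots> = (s (a k) * \<Lambda> k) * ?B"
        by (simp add: algebra_simps)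
      finally have 1: "X t w \<le> (s (a k) * \<Lambda> k) * ?B" by simp
      have B0: "0 \<le> ?B"
        using \<eta> A const S0 \<theta> s(2) by (intro add_nonneg_nonneg) auto
      have t0: "0 < t" "1 / b k \<le> 1 / t"
        using t ab[of k] by (auto intro: divide_left_mono)
      have "real k * q = ln (1 / b k)"
        using \<theta> by (simp add: q_def b_def ln_div ln_realpow)
      also have "\<dots> \<le> ln (1 / t)"
        using t0 ab(5)[of k] by (intro ln_mono) auto
      finally have "real k * q \<le> ln (1 / t)" .
      then have L: "\<Lambda> k \<le> ln (ln (1 / t))"
        unfolding \<Lambda>_def using kq[OF k1] exp_gt_zero[of "1::real"] by (intro ln_mono) linarith+
      have st: "s (a k) \<le> s t"
        using s(1) t by (simp add: monoD)
      have pos: "0 < s t * ln (ln (1 / t))"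
        using st sa L \<Lambda>[OF k1] by (intro mult_pos_pos) linarith+
      have "(s (a k) * \<Lambda> k) * ?B \<le> (s t * ln (ln (1 / t))) * ?B"
        using st L sa \<Lambda>[OF k1] by (intro mult_right_mono mult_mono B0) linarith+
      with 1 have "X t w \<le> ?B * (s t * ln (ln (1 / t)))"
        by (simp only: mult.commute[of ?B])
      then show ?thesis
        using pos by (simp only: pos_divide_le_eq)
    qed
    have "\<forall>\<^sub>F t in at_right 0. X t w / (s t * ln (ln (1 / t))) \<le> ?B"
    proof (rule eventually_at_rightI[of 0 "\<theta> ^ (J + k1)"])
      fix t assume t: "t \<in> {0<..<\<theta> ^ (J + k1)}"
      then obtain n where n: "\<theta> ^ n < t"
        using real_arch_pow_inv[of t \<theta>] \<theta> by auto
      \<comment> \<open>The least index whose left end is at most \<open>t\<close> singles out the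
        block containing \<open>t\<close>; smallness of \<open>t\<close> makes it late
        enough.\<close>
      define k where "k = (LEAST k. \<theta> ^ Suc k \<le> t)"
      have "\<theta> ^ Suc n \<le> \<theta> ^ n"
        using \<theta> by (intro power_decreasing) auto
      then have "\<theta> ^ Suc n \<le> t"
        using n by linarith
      then have kt: "\<theta> ^ Suc k \<le> t"
        unfolding k_def by (rule LeastI)
      have tk: "t \<le> \<theta> ^ k"
      proof (cases k)
        case 0
        have "\<theta> ^ (J + k1) \<le> 1"
          using \<theta> by (intro power_le_one) auto
        then show ?thesis using t 0 by simp
      next
        case (Suc i)
        then have "\<not> \<theta> ^ Suc i \<le> t"
          using not_less_Least[of i "\<lambda>k. \<theta> ^ Suc k \<le> t"] by (simp add: k_def)
        then show ?thesis using Suc by simp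
      qed
      have "J + k1 \<le> k"
      proof (rule ccontr)
        assume "\<not> J + k1 \<le> k"
        then have "\<theta> ^ (J + k1) \<le> \<theta> ^ Suc k"
          using \<theta> by (intro power_decreasing) auto
        then show False using kt t by simp
      qed
      from block[OF this] kt tk show "X t w / (s t * ln (ln (1 / t))) \<le> ?B"
        by (simp only: a_def b_def)
    qed (use \<theta> in simp)
    then show ?case
      by (intro Limsup_bounded) simp
  qed
qed

text \<open>Taking \<open>\<eta> = 1 / (n + 1)\<close> and \<open>\<theta> = 1 - 1 / (n + 2)\<close>
  keeps the exceptional sets countable in number, and the bounds tend to \<open>A\<close>.\<close>

lemma limsup_bound:
  fixes s :: "real \<Rightarrow> real" and A c t0 :: real
  assumes cont: "AE w in M. continuous_on {0..1} (\<lambda>t. X t w)"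
    and s: "mono s" "0 < c" "0 < t0" "\<And>t. 0 < t \<Longrightarrow> t \<le> t0 \<Longrightarrow> c * t \<le> s t"
    and A: "0 < A"
    and one: "\<And>\<eta>. 0 < \<eta> \<Longrightarrow> \<exists>D\<ge>0. \<forall>t x. 0 < t \<longrightarrow> t \<le> 1 \<longrightarrow>
      prob {w \<in> space M. (1 + \<eta>) * x * (A * s t) \<le> X t w} \<le> D * exp (- (1 + \<eta> / 2) * x)"
  shows "AE w in M. Limsup (at_right 0) (\<lambda>t. ereal (X t w / (s t * ln (ln (1 / t))))) \<le> ereal A"
proof -
  define S where "S = (\<Sum>n. real (Suc n) * sqrt (1/2) ^ n)"
  define B where "B n = (1 + inverse (real (Suc n))) * A +
    2 * \<kappa> * S * sqrt (inverse (real (Suc (Suc n)))) / ((1 - inverse (real (Suc (Suc n)))) * c)" for n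
  have "AE w in M. Limsup (at_right 0) (\<lambda>t. ereal (X t w / (s t * ln (ln (1 / t))))) \<le> ereal (B n)" for n
  proof -
    have \<eta>: "0 < inverse (real (Suc n))" by simp
    from one[OF this] obtain D where D: "D \<ge> 0" "\<And>t x. 0 < t \<Longrightarrow> t \<le> 1 \<Longrightarrow>
      prob {w \<in> space M. (1 + inverse (real (Suc n))) * x * (A * s t) \<le> X t w}
        \<le> D * exp (- (1 + inverse (real (Suc n)) / 2) * x)"
      by metis
    have \<theta>: "0 < 1 - inverse (real (Suc (Suc n)))" "1 - inverse (real (Suc (Suc n))) < 1"
      by (simp_all add: field_simps)
    show ?thesis
      using limsup_bound_geometric[OF cont s A \<eta> \<theta> D] by (simp add: B_def S_def)
  qed
  then have "AE w in M. \<forall>n. Limsup (at_right 0) (\<lambda>t. ereal (X t w / (s t * ln (ln (1 / t))))) \<le> ereal (B n)"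
    by (simp add: AE_all_countable)
  moreover have "(\<lambda>n. ereal (B n)) \<longlonglongrightarrow> ereal A"
  proof -
    have "B \<longlonglongrightarrow> (1 + 0) * A + 2 * \<kappa> * S * sqrt 0 / ((1 - 0) * c)"
      unfolding B_def using s(2)
      by (intro tendsto_intros LIMSEQ_inverse_real_of_nat LIMSEQ_Suc[OF LIMSEQ_inverse_real_of_nat]) auto
    then show ?thesis by simp
  qed
  ultimately show ?thesis
    by (auto elim!: eventually_mono intro: LIMSEQ_le_const)
qed

end
end

theorem theorem1p6:
  fixes M :: "'w measure" and P :: "real \<Rightarrow> 'w measure" and Z :: "real \<Rightarrow> 'w \<Rightarrow> ereal"
    and m :: "real measure" and a c s :: "real \<Rightarrow> real" and \<mu> :: "real measure"
    and \<alpha> :: real and N :: "'b measure" and X :: "real \<Rightarrow> 'b \<Rightarrow> real"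
  assumes "real_diffusion M P Z"
    and "regular_without_traps P Z"
    and "sigma_finite_measure m" and "speed_measure P Z s m" and "symmetric_wrt P Z m"
    and "absolutely_continuous lborel m"
    and "continuous_on UNIV (\<lambda>x. (a x)\<^sup>2)" and "continuous_on UNIV c" and "\<forall>x. a x \<noteq> 0"
    and "has_generator_form P Z a c"
    and "scale_function P Z s" and "C2 s" and "s 0 = 0" and "filterlim s at_top at_top"
    and "finite_measure \<mu>" and "sets \<mu> = sets (restrict_space borel {0<..})"
    and "0 < \<alpha>"
    and "permanental_process \<alpha> {0..1} (v_kernel s \<mu>) N X"
  shows "\<exists>\<delta> Y. 0 < \<delta> \<and> \<delta> \<le> 1 \<and> is_version {0..1} N X Y \<and>
           (AE w in N. continuous_on {0..\<delta>} (\<lambda>t. Y t w)) \<and>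
           (AE w in N. Limsup (at_right 0) (\<lambda>t. ereal (Y t w / (s t * ln (ln (1 / t)))))
                         \<le> ereal (1 + measure \<mu> (space \<mu>)))"
proof -
  interpret N: prob_space N
    using assms(18) by (rule permanental_prob_space)
  define mass where "mass = measure \<mu> (space \<mu>)"
  have mass: "0 \<le> mass" by (simp add: mass_def)
  have s: "strict_mono s" "continuous_on UNIV s" "s 0 = 0"
    using assms(11,13) by (auto simp: scale_function_def)
  note hyps = assms(18,17) s assms(15,16) mass_def
  obtain L where L: "0 < L" "\<And>r t. 0 \<le> r \<Longrightarrow> r \<le> t \<Longrightarrow> t \<le> 1 \<Longrightarrow> s t - s r \<le> L * (t - r)"
    using C2_lipschitz[OF assms(12)] by blast
  obtain k b where k: "0 < k" "0 < b" "\<And>x. 0 < x \<Longrightarrow> x < b \<Longrightarrow> k * x \<le> s x"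
    using scale_lower_bound[OF assms(1,11,13,10,7,8)] assms(9) by blast
  define \<kappa> where "\<kappa> = 4 * (1 + mass) * L"
  define C where "C = 2 * 2 powr \<alpha>"
  have const: "0 < \<kappa>" "0 \<le> C"
    using L(1) mass by (auto simp: \<kappa>_def C_def)
  have X_meas: "X t \<in> borel_measurable N" if "t \<in> {0..1}" for t
    using assms(18) that by (rule permanental_measurable)
  have X_tail: "N.prob {w \<in> space N. x * (\<kappa> * sqrt (max r t * \<bar>t - r\<bar>)) \<le> \<bar>X t w - X r w\<bar>} \<le> C * exp (- x)"
    if "r \<in> {0..1}" "t \<in> {0..1}" "r \<noteq> t" for r t x
    unfolding \<kappa>_def C_def by (rule tail_increment_lipschitz[OF hyps L that])
  define Y where "Y t w = lim (\<lambda>n. X (dyadic_floor n t) w)" for t w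
  have Y: "is_version {0..1} N X Y" "AE w in N. continuous_on {0..1} (\<lambda>t. Y t w)"
    unfolding Y_def[abs_def] by (rule N.continuous_version_exists[OF X_meas const X_tail]; assumption)+
  have Y_meas: "Y t \<in> borel_measurable N" and Y_eq: "AE w in N. Y t w = X t w" if "t \<in> {0..1}" for t
    using Y(1) that by (simp_all add: is_version_def)
  \<comment> \<open>The chaining estimates concern the process whose paths are continuous, so the
    tails are carried over to \<open>Y\<close>; this involves only two times and hence one null
    set.\<close>
  have Y_tail: "N.prob {w \<in> space N. x * (\<kappa> * sqrt (max r t * \<bar>t - r\<bar>)) \<le> \<bar>Y t w - Y r w\<bar>} \<le> C * exp (- x)"
    if rt: "r \<in> {0..1}" "t \<in> {0..1}" "r \<noteq> t" for r t x
  proof -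
    have [measurable]: "X t \<in> borel_measurable N" "X r \<in> borel_measurable N"
      "Y t \<in> borel_measurable N" "Y r \<in> borel_measurable N"
      using X_meas Y_meas rt by auto
    have "N.prob {w \<in> space N. x * (\<kappa> * sqrt (max r t * \<bar>t - r\<bar>)) \<le> \<bar>Y t w - Y r w\<bar>} =
        N.prob {w \<in> space N. x * (\<kappa> * sqrt (max r t * \<bar>t - r\<bar>)) \<le> \<bar>X t w - X r w\<bar>}"
    proof (rule N.finite_measure_eq_AE)
      show "AE w in N. w \<in> {w \<in> space N. x * (\<kappa> * sqrt (max r t * \<bar>t - r\<bar>)) \<le> \<bar>Y t w - Y r w\<bar>} \<longleftrightarrow>
          w \<in> {w \<in> space N. x * (\<kappa> * sqrt (max r t * \<bar>t - r\<bar>)) \<le> \<bar>X t w - X r w\<bar>}"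
        using Y_eq[OF rt(1)] Y_eq[OF rt(2)] by eventually_elim simp
    qed measurable
    then show ?thesis
      using X_tail[OF rt, of x] by simp
  qed
  have one: "\<exists>D\<ge>0. \<forall>t x. 0 < t \<longrightarrow> t \<le> 1 \<longrightarrow>
      N.prob {w \<in> space N. (1 + \<eta>) * x * ((1 + mass) * s t) \<le> Y t w} \<le> D * exp (- (1 + \<eta> / 2) * x)"
    if \<eta>: "0 < \<eta>" for \<eta>
  proof (intro exI conjI allI impI)
    \<comment> \<open>Chosen to solve \<open>(1 - \<beta>) * (1 + \<eta>) = 1 + \<eta> / 2\<close>:
      half of the excess \<eta> is given up to stay away from the singularity, the other half
      remains for summability.\<close>
    define \<beta> where "\<beta> = (\<eta> / 2) / (1 + \<eta>)"
    have \<beta>: "0 < \<beta>" "\<beta> < 1" "(1 - \<beta>) * (1 + \<eta>) = 1 + \<eta> / 2"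
      using \<eta> by (auto simp: \<beta>_def field_simps)
    show "0 \<le> \<beta> powr - \<alpha>" by simp
    fix t x :: real assume t: "0 < t" "t \<le> 1"
    have [measurable]: "X t \<in> borel_measurable N" "Y t \<in> borel_measurable N"
      using X_meas Y_meas t by auto
    have "N.prob {w \<in> space N. (1 + \<eta>) * x * ((1 + mass) * s t) \<le> Y t w} =
        N.prob {w \<in> space N. (1 + \<eta>) * x * ((1 + mass) * s t) \<le> X t w}"
    proof (rule N.finite_measure_eq_AE)
      show "AE w in N. w \<in> {w \<in> space N. (1 + \<eta>) * x * ((1 + mass) * s t) \<le> Y t w} \<longleftrightarrow>
          w \<in> {w \<in> space N. (1 + \<eta>) * x * ((1 + mass) * s t) \<le> X t w}"
        using Y_eq[of t, simplified, OF conjI[OF less_imp_le[OF t(1)] t(2)]] by eventually_elim simp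
    qed measurable
    also have "\<dots> \<le> \<beta> powr - \<alpha> * exp (- (1 - \<beta>) * ((1 + \<eta>) * x))"
      by (rule tail_one_point[OF hyps t \<beta>(1,2)])
    also have "- (1 - \<beta>) * ((1 + \<eta>) * x) = - ((1 - \<beta>) * (1 + \<eta>)) * x"
      by (simp only: mult.assoc mult_minus_left)
    also have "\<dots> = - (1 + \<eta> / 2) * x"
      unfolding \<beta>(3) ..
    finally show "N.prob {w \<in> space N. (1 + \<eta>) * x * ((1 + mass) * s t) \<le> Y t w} \<le>
        \<beta> powr - \<alpha> * exp (- (1 + \<eta> / 2) * x)" .
  qed
  have "AE w in N. Limsup (at_right 0) (\<lambda>t. ereal (Y t w / (s t * ln (ln (1 / t))))) \<le> ereal (1 + mass)"
  proof (rule N.limsup_bound[OF Y_meas const Y_tail Y(2), where c=k and ?t0.0="b / 2"])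
    show "mono s" using s(1) by (rule strict_mono_mono)
    show "0 < b / 2" "0 < k" "0 < 1 + mass"
      using k mass by auto
    \<comment> \<open>Halving \<open>b\<close> turns the open range of the lower bound into a closed
      one.\<close>
    show "k * t \<le> s t" if "0 < t" "t \<le> b / 2" for t
      using k that by simp
  qed (use one in auto)
  then show ?thesis
    using Y by (intro exI[of _ 1] exI[of _ Y]) (simp add: mass_def)
qed

end
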